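(* For a function $F : [0,\infty) \to \mathbb{R}$, the following are equivalent. (1) Applied entrywise, $F$ preserves positive semidefiniteness on the set $\mathcal{H}^{++}$ of all totally non-negative Hankel matrices, that is, $F[A]$ is positive semidefinite for every $A \in \mathcal{H}^{++}$. (2) Applied entrywise, $F$ preserves the set $\mathcal{H}^{++}$, that is, $F[A] \in \mathcal{H}^{++}$ for every $A \in \mathcal{H}^{++}$. (3) Applied entrywise, $F$ sends $\mathcal{M}([0,\infty))$ to itself. (4) $F$ agrees on $(0,\infty)$ with an absolutely monotonic entire function and $0 \leq F(0) \leq \lim_{\epsilon \to 0^+} F(\epsilon)$.
   Context: A matrix is totally non-negative if all of its minors are non-negative. $\mathcal{H}^{++} := \bigcup_{n \geq 1} \mathcal{H}^{++}_n$, where $\mathcal{H}^{++}_n$ is the set of $n \times n$ totally non-negative (real) Hankel matrices. For a matrix $A = (a_{ij})$, $F[A] := (F(a_{ij}))$; for a sequence, $F[(s_k)_{k \geq 0}] := (F(s_k))_{k\geq 0}$. An admissible measure is a non-negative measure $\mu$ on $\mathbb{R}$ possessing moments of all orders; its moments are $s_k(\mu) := \int_{\mathbb{R}} x^k \, d\mu$ ($k \geq 0$), where $s_0(\mu)$ is the total mass. For $K \subset \mathbb{R}$, $\mathcal{M}(K)$ denotes the set of moment sequences $(s_k(\mu))_{k \geq 0}$ of admissible measures $\mu$ supported on $K$. An absolutely monotonic entire function is an entire function all of whose Taylor coefficients at $0$ are non-negative. *)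

theory Defs
  imports
    "HOL-Complex_Analysis.Complex_Analysis"
    "Jordan_Normal_Form.Determinant"
    "Jordan_Normal_Form.DL_Submatrix"
begin

(* Constants that also exist in HOL-Analysis for type-indexed matrices (det, inner product) are
   written with their Jordan_Normal_Form names. *)

definition psd_mat :: "real mat \<Rightarrow> bool" where
  "psd_mat A \<longleftrightarrow>
     square_mat A \<and> transpose_mat A = A \<and>
     (\<forall>v \<in> carrier_vec (dim_row A). 0 \<le> Matrix.scalar_prod v (A *\<^sub>v v))"

(* For I and J empty the minor is the determinant of the 0 x 0 matrix, which is 1; the empty
   minor thus imposes no condition. *)
definition totally_nonneg_mat :: "real mat \<Rightarrow> bool" where
  "totally_nonneg_mat A \<longleftrightarrow>
     (\<forall>I J. I \<subseteq> {..<dim_row A} \<and> J \<subseteq> {..<dim_col A} \<and> card I = card J \<longrightarrow>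
        0 \<le> Determinant.det (submatrix A I J))"

definition hankel_mat :: "nat \<Rightarrow> (nat \<Rightarrow> real) \<Rightarrow> real mat" where
  "hankel_mat n s = Matrix.mat n n (\<lambda>(i, j). s (i + j))"

definition tn_hankel_dim :: "nat \<Rightarrow> real mat set" where
  "tn_hankel_dim n = {A. (\<exists>s. A = hankel_mat n s) \<and> totally_nonneg_mat A}"

definition tn_hankel :: "real mat set" where
  "tn_hankel = (\<Union>n\<in>{1..}. tn_hankel_dim n)"

(* The case k = 0 of integrability says that the total mass is finite. *)
definition admissible_measure :: "real measure \<Rightarrow> bool" where
  "admissible_measure M \<longleftrightarrow>
     sets M = sets borel \<and> (\<forall>k::nat. integrable M (\<lambda>x. x ^ k))"

definition moment :: "real measure \<Rightarrow> nat \<Rightarrow> real" where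
  "moment M k = (LINT x|M. x ^ k)"

(* Supported on K means that the complement of K is a null set. For closed K, such as {0..}, this
   is equivalent to K containing the topological support of M. *)
definition moment_seqs :: "real set \<Rightarrow> (nat \<Rightarrow> real) set" where
  "moment_seqs K = {moment M | M. admissible_measure M \<and> (AE x in M. x \<in> K)}"

(* Membership in nonneg_Reals says that the complex number is real and non-negative. *)
definition abs_monotonic_entire :: "(complex \<Rightarrow> complex) \<Rightarrow> bool" where
  "abs_monotonic_entire g \<longleftrightarrow>
     g holomorphic_on UNIV \<and> (\<forall>n. (deriv ^^ n) g 0 / fact n \<in> \<real>\<^sub>\<ge>\<^sub>0)"

(* A function F on [0,\<infinity>) is represented by F :: real \<Rightarrow> real of which only the values on {0..} are
   used: entries of matrices in tn_hankel are 1 x 1 minors, hence non-negative, and so are moments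
   of measures supported on {0..}. *)

definition preserves_psd_on_tn_hankel :: "(real \<Rightarrow> real) \<Rightarrow> bool" where
  "preserves_psd_on_tn_hankel F \<longleftrightarrow> (\<forall>A \<in> tn_hankel. psd_mat (map_mat F A))"

definition preserves_tn_hankel :: "(real \<Rightarrow> real) \<Rightarrow> bool" where
  "preserves_tn_hankel F \<longleftrightarrow> (\<forall>A \<in> tn_hankel. map_mat F A \<in> tn_hankel)"

definition preserves_moment_seqs :: "(real \<Rightarrow> real) \<Rightarrow> real set \<Rightarrow> bool" where
  "preserves_moment_seqs F K \<longleftrightarrow> (\<forall>s \<in> moment_seqs K. (\<lambda>k. F (s k)) \<in> moment_seqs K)"

end

theory Submission
  imports Defs "HOL-Probability.Probability_Mass_Function"
begin

text \<open>Each of the three preservation properties implies that \<open>F\<close> preserves positivity on a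
small explicit family of Hankel matrices, and this already makes \<open>F\<close> a power series
with non-negative coefficients on the positive half-line. Conversely, such power series have the
three preservation properties, also when the value at 0 is replaced by a smaller non-negative one.

\<^bold>\<open>Necessity.\<close> A measure \<open>a \<delta>\<^sub>x + b \<delta>\<^sub>y\<close>
on the half-line with two atoms has the moments \<open>a x\<^sup>m + b y\<^sup>m\<close>, and all
its Hankel matrices are totally non-negative. So each preservation property implies
\<open>two_atom_psd F\<close>: the matrices with entries \<open>F (a x\<^sup>(i+j) + b
y\<^sup>(i+j))\<close> are positive semidefinite. The 2 by 2 matrices make \<open>F\<close>
non-negative, increasing and multiplicatively midpoint convex, hence continuous on the positive
half-line. For the larger ones take \<open>x = 1\<close> and \<open>y = q < 1\<close>. A test vector
that annihilates the vectors \<open>(q\<^sup>(k i))\<close> for \<open>k < N\<close> isolates the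
term of order \<open>N\<close> in the Taylor expansion of \<open>F\<close> at \<open>a\<close>;
letting \<open>b\<close> tend to 0 gives the \<open>N\<close>-th derivative a sign (an argument of
Horn and Loewner, \<open>loewner_derivative_nonneg\<close>). Since \<open>F\<close> is only
continuous, the argument is applied to the \<open>N\<close>-th difference of an
\<open>N\<close>-fold primitive of \<open>F\<close>, whose \<open>N\<close>-th derivative is the
\<open>N\<close>-th difference of \<open>F\<close>. So all forward differences of \<open>F\<close>
are non-negative. The Bernstein polynomials of \<open>F\<close> on an interval \<open>[0, R]\<close>
have non-negative multiples of these differences as coefficients; they converge to \<open>F\<close>,
and by Montel's theorem a subsequence, with \<open>R\<close> growing, converges to an entire
function with non-negative Taylor coefficients.

\<^bold>\<open>Sufficiency for Hankel matrices.\<close> The key is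
\<open>totally_nonneg_hankel_iff\<close>: a Hankel matrix is totally non-negative if and only if
both it and the Hankel matrix of the shifted sequence are positive semidefinite. The latter
condition survives an entrywise power series with non-negative coefficients by the Schur product
theorem. From left to right, the principal minors of the two matrices are among the minors of the
first. From right to left, one perturbs to the positive definite case; there every contiguous minor
is a principal minor of one of the two matrices, so is positive, and Fekete's principle
(\<open>fdet_rows_pos_of_contiguous\<close>) extends positivity to all minors. The possible jump of
\<open>F\<close> at 0 is felt only by matrices with a zero entry, and these have a trivial shape
(\<open>hankel_zero_entries\<close>).

\<^bold>\<open>Sufficiency for moment sequences.\<close> The \<open>j\<close>-th powers of the
moments of \<open>\<mu>\<close> are the moments of the law of the product of \<open>j\<close>
independent copies of \<open>\<mu>\<close>. Mixing these laws over \<open>j\<close> with the Taylor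
coefficients of \<open>F\<close> as weights represents the transformed sequence. A moment vanishes
only for multiples of the point mass at 0, and then two atoms suffice.\<close>

section \<open>Determinants of finite sections of infinite matrices\<close>

text \<open>With an unbounded index type, minors, shifts and Schur complements are obtained by composing index
functions, without carrier conditions.\<close>

definition fdet :: "nat \<Rightarrow> (nat \<Rightarrow> nat \<Rightarrow> real) \<Rightarrow> real" where
  "fdet n a = Determinant.det (Matrix.mat n n (\<lambda>(i, j). a i j))"

lemma fdet_expand:
  "fdet n a = (\<Sum>p | p permutes {0..<n}. signof p * (\<Prod>i = 0..<n. a i (p i)))"
proof -
  have "fdet n a = (\<Sum>p | p permutes {0..<n}. signof p *
          (\<Prod>i = 0..<n. Matrix.mat n n (\<lambda>(i, j). a i j) $$ (i, p i)))"
    unfolding fdet_def by (rule det_def') simp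
  also have "\<dots> = (\<Sum>p | p permutes {0..<n}. signof p * (\<Prod>i = 0..<n. a i (p i)))"
  proof (intro sum.cong refl arg_cong2[where f = "(*)"] prod.cong)
    fix p i assume "p \<in> {p. p permutes {0..<n}}" and i: "i \<in> {0..<n}"
    then have "p i \<in> {0..<n}" using permutes_in_image by fastforce
    then show "Matrix.mat n n (\<lambda>(i, j). a i j) $$ (i, p i) = a i (p i)" using i by simp
  qed
  finally show ?thesis .
qed

lemma fdet_cong:
  assumes "\<And>i j. i < n \<Longrightarrow> j < n \<Longrightarrow> a i j = b i j"
  shows "fdet n a = fdet n b"
  unfolding fdet_def by (rule arg_cong[where f = Determinant.det], rule eq_matI) (auto simp: assms)

lemma fdet_0 [simp]: "fdet 0 a = 1"
  by (simp add: fdet_def)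

lemma fdet_2: "fdet 2 a = a 0 0 * a 1 1 - a 0 1 * a 1 0"
proof -
  have two: "{0..<2::nat} = {0, 1}" by auto
  have "{p. p permutes {0, 1::nat}} = {id, Transposition.transpose 0 1}"
    by (auto simp: permutes_doubleton_iff)
  moreover have "id \<noteq> Transposition.transpose (0::nat) 1"
    by (metis id_apply transpose_apply_first zero_neq_one)
  ultimately show ?thesis
    unfolding fdet_expand two by (simp add: sign_swap_id)
qed

lemma fdet_transpose: "fdet n (\<lambda>i j. a j i) = fdet n a"
proof -
  have "Matrix.mat n n (\<lambda>(i, j). a j i) = transpose_mat (Matrix.mat n n (\<lambda>(i, j). a i j))"
    by (rule eq_matI) auto
  then show ?thesis unfolding fdet_def by (simp add: det_transpose[of _ n])
qed

text \<open>All row operations below are instances of this: the rows of \<open>a\<close> are lower triangular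
combinations of those of \<open>c\<close>.\<close>

lemma fdet_lower_triangular_factor:
  assumes "\<And>i j. i < n \<Longrightarrow> j < n \<Longrightarrow> a i j = (\<Sum>l\<le>i. m i l * c l j)"
  shows "fdet n a = (\<Prod>i<n. m i i) * fdet n c"
proof -
  define M where "M = Matrix.mat n n (\<lambda>(i, l). if l \<le> i then m i l else 0)"
  define C where "C = Matrix.mat n n (\<lambda>(i, j). c i j)"
  have "Matrix.mat n n (\<lambda>(i, j). a i j) = M * C"
  proof (rule eq_matI)
    fix i j assume "i < dim_row (M * C)" "j < dim_col (M * C)"
    then have ij: "i < n" "j < n" by (auto simp: M_def C_def)
    have "(M * C) $$ (i, j) = (\<Sum>l = 0..<n. (if l \<le> i then m i l else 0) * c l j)"
      using ij by (simp add: M_def C_def scalar_prod_def)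
    also have "\<dots> = (\<Sum>l\<le>i. m i l * c l j)"
      by (rule sum.mono_neutral_cong_right) (use ij in auto)
    finally show "Matrix.mat n n (\<lambda>(i, j). a i j) $$ (i, j) = (M * C) $$ (i, j)"
      using ij assms by simp
  qed (auto simp: M_def C_def)
  moreover have "Determinant.det (M * C) = Determinant.det M * Determinant.det C"
    by (rule det_mult[where n = n]) (auto simp: M_def C_def)
  moreover have "Determinant.det M = prod_list (diag_mat M)"
    by (rule det_lower_triangular[where n = n]) (auto simp: M_def)
  moreover have "prod_list (diag_mat M) = (\<Prod>i<n. m i i)"
    by (simp add: diag_mat_def M_def prod.list_conv_set_nth atLeast0LessThan)
  ultimately show ?thesis by (simp add: fdet_def C_def)
qed

lemma fdet_first_column_zero:
  assumes "\<And>i. i < n \<Longrightarrow> a (Suc i) 0 = 0"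
  shows "fdet (Suc n) a = a 0 0 * fdet n (\<lambda>i j. a (Suc i) (Suc j))"
proof -
  define A1 A2 A3 A4 where
    "A1 = Matrix.mat 1 1 (\<lambda>_. a 0 0)" and "A2 = Matrix.mat 1 n (\<lambda>(i, j). a 0 (Suc j))"
    and "A3 = (0\<^sub>m n 1 :: real mat)" and "A4 = Matrix.mat n n (\<lambda>(i, j). a (Suc i) (Suc j))"
  have "Matrix.mat (Suc n) (Suc n) (\<lambda>(i, j). a i j) = four_block_mat A1 A2 A3 A4"
  proof (rule eq_matI)
    fix i j
    assume "i < dim_row (four_block_mat A1 A2 A3 A4)" "j < dim_col (four_block_mat A1 A2 A3 A4)"
    then have "i < Suc n" "j < Suc n" by (auto simp: A1_def A2_def A3_def A4_def)
    then show "Matrix.mat (Suc n) (Suc n) (\<lambda>(i, j). a i j) $$ (i, j) =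
        four_block_mat A1 A2 A3 A4 $$ (i, j)"
      by (cases i; cases j) (auto simp: A1_def A2_def A3_def A4_def assms)
  qed (auto simp: A1_def A2_def A3_def A4_def)
  moreover have "Determinant.det (four_block_mat A1 A2 A3 A4) = Determinant.det A1 * Determinant.det A4"
    by (rule det_four_block_mat_lower_left_zero_col[where n = n])
       (auto simp: A1_def A2_def A3_def A4_def)
  moreover have "Determinant.det A1 = a 0 0"
    unfolding A1_def by (subst det_single) auto
  ultimately show ?thesis by (simp add: fdet_def A4_def)
qed

lemma fdet_1: "fdet (Suc 0) a = a 0 0"
  by (subst fdet_first_column_zero) auto

lemma fdet_row_sum:
  assumes "finite S" "m < n"
  shows "fdet n (\<lambda>i j. if i = m then (\<Sum>l\<in>S. x l j) else y i j) =
    (\<Sum>l\<in>S. fdet n (\<lambda>i j. if i = m then x l j else y i j))"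
proof -
  have pull_row_out: "(\<Prod>i = 0..<n. if i = m then u (p i) else y i (p i)) =
      u (p m) * (\<Prod>i \<in> {0..<n} - {m}. y i (p i))"
    for u :: "nat \<Rightarrow> real" and p
  proof -
    have "(\<Prod>i = 0..<n. if i = m then u (p i) else y i (p i)) =
       (if m = m then u (p m) else y m (p m)) *
       (\<Prod>i \<in> {0..<n} - {m}. if i = m then u (p i) else y i (p i))"
      by (rule prod.remove) (use assms in auto)
    also have "(\<Prod>i \<in> {0..<n} - {m}. if i = m then u (p i) else y i (p i)) =
      (\<Prod>i \<in> {0..<n} - {m}. y i (p i))"
      by (rule prod.cong) auto
    finally show ?thesis by simp
  qed
  have "fdet n (\<lambda>i j. if i = m then u j else y i j) =
     (\<Sum>p | p permutes {0..<n}. signof p * (u (p m) * (\<Prod>i \<in> {0..<n} - {m}. y i (p i))))" for u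
    unfolding fdet_expand by (subst pull_row_out) (rule refl)
  note expand_row = this
  show ?thesis
    unfolding expand_row sum_distrib_left sum_distrib_right by (rule sum.swap)
qed

lemma tendsto_fdet:
  assumes "\<And>i j. i < n \<Longrightarrow> j < n \<Longrightarrow> ((\<lambda>e. a e i j) \<longlongrightarrow> b i j) G"
  shows "((\<lambda>e. fdet n (a e)) \<longlongrightarrow> fdet n b) G"
  unfolding fdet_expand
proof (intro tendsto_sum tendsto_mult tendsto_const tendsto_prod)
  fix p i assume "p \<in> {p. p permutes {0..<n}}" and i: "i \<in> {0..<n}"
  then have "p i \<in> {0..<n}" using permutes_in_image by fastforce
  then show "((\<lambda>e. a e i (p i)) \<longlongrightarrow> b i (p i)) G" using i assms by simp
qed

lemma fdet_pivot:
  assumes "a 0 0 \<noteq> 0"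
  shows "fdet (Suc n) a = a 0 0 * fdet n (\<lambda>i j. a (Suc i) (Suc j) - a (Suc i) 0 * a 0 (Suc j) / a 0 0)"
proof -
  define c where "c = (\<lambda>i j. if i = 0 then a 0 j else a i j - a i 0 * a 0 j / a 0 0)"
  define m where "m = (\<lambda>i l. if l = i then 1 else if l = 0 then a i 0 / a 0 0 else 0)"
  have "fdet (Suc n) a = (\<Prod>i<Suc n. m i i) * fdet (Suc n) c"
  proof (rule fdet_lower_triangular_factor[where m = m])
    fix i j
    show "a i j = (\<Sum>l\<le>i. m i l * c l j)"
    proof (cases i)
      case (Suc k)
      have "(\<Sum>l\<le>i. m i l * c l j) = (\<Sum>l\<in>{0, i}. m i l * c l j)"
        by (rule sum.mono_neutral_right) (auto simp: m_def)
      then show ?thesis by (simp add: Suc m_def c_def)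
    qed (simp add: m_def c_def)
  qed
  moreover have "fdet (Suc n) c = c 0 0 * fdet n (\<lambda>i j. c (Suc i) (Suc j))"
    by (rule fdet_first_column_zero) (use assms in \<open>simp add: c_def\<close>)
  ultimately show ?thesis by (simp add: m_def c_def)
qed

section \<open>Quadratic forms and positive semidefiniteness\<close>

definition quad_form :: "nat \<Rightarrow> (nat \<Rightarrow> nat \<Rightarrow> real) \<Rightarrow> (nat \<Rightarrow> real) \<Rightarrow> real" where
  "quad_form n a v = (\<Sum>i<n. \<Sum>j<n. v i * v j * a i j)"

definition symm :: "nat \<Rightarrow> (nat \<Rightarrow> nat \<Rightarrow> real) \<Rightarrow> bool" where
  "symm n a \<longleftrightarrow> (\<forall>i<n. \<forall>j<n. a i j = a j i)"

definition psd :: "nat \<Rightarrow> (nat \<Rightarrow> nat \<Rightarrow> real) \<Rightarrow> bool" where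
  "psd n a \<longleftrightarrow> (\<forall>v. 0 \<le> quad_form n a v)"

definition pos_def :: "nat \<Rightarrow> (nat \<Rightarrow> nat \<Rightarrow> real) \<Rightarrow> bool" where
  "pos_def n a \<longleftrightarrow> (\<forall>v. (\<exists>i<n. v i \<noteq> 0) \<longrightarrow> 0 < quad_form n a v)"

text \<open>The Schur complement of the entry in the upper left corner, re-indexed from 0.\<close>

definition schur :: "(nat \<Rightarrow> nat \<Rightarrow> real) \<Rightarrow> nat \<Rightarrow> nat \<Rightarrow> real" where
  "schur a = (\<lambda>i j. a (Suc i) (Suc j) - a (Suc i) 0 * a 0 (Suc j) / a 0 0)"

lemma quad_form_cong:
  assumes "\<And>i j. i < n \<Longrightarrow> j < n \<Longrightarrow> a i j = b i j" "\<And>i. i < n \<Longrightarrow> v i = w i"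
  shows "quad_form n a v = quad_form n b w"
  unfolding quad_form_def using assms by simp

lemma quad_form_Suc:
  assumes "symm (Suc n) a"
  shows "quad_form (Suc n) a v = a 0 0 * (v 0)\<^sup>2 + 2 * v 0 * (\<Sum>i<n. v (Suc i) * a 0 (Suc i)) +
    quad_form n (\<lambda>i j. a (Suc i) (Suc j)) (\<lambda>i. v (Suc i))"
proof -
  have "(\<Sum>i<n. v (Suc i) * v 0 * a (Suc i) 0) = v 0 * (\<Sum>i<n. v (Suc i) * a 0 (Suc i))"
    unfolding sum_distrib_left by (intro sum.cong refl) (use assms in \<open>auto simp: symm_def\<close>)
  moreover have "(\<Sum>j<n. v 0 * v (Suc j) * a 0 (Suc j)) = v 0 * (\<Sum>i<n. v (Suc i) * a 0 (Suc i))"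
    unfolding sum_distrib_left by (simp add: mult.assoc)
  ultimately show ?thesis
    unfolding quad_form_def sum.lessThan_Suc_shift sum.distrib by (simp add: power2_eq_square)
qed

text \<open>Completing the square in the first variable. The three inductions on the size of a matrix below (on
principal minors, on the determinant and on Gram representations) all remove the first index in this
way.\<close>

lemma quad_form_schur:
  assumes sym: "symm (Suc n) a" and nz: "a 0 0 \<noteq> 0"
  shows "quad_form (Suc n) a v =
    a 0 0 * (v 0 + (\<Sum>i<n. v (Suc i) * a 0 (Suc i)) / a 0 0)\<^sup>2 + quad_form n (schur a) (\<lambda>i. v (Suc i))"
proof -
  define S where "S = (\<Sum>i<n. v (Suc i) * a 0 (Suc i))"
  have col0: "a (Suc i) 0 = a 0 (Suc i)" if "i < n" for i
    using sym that by (simp add: symm_def)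
  have "quad_form n (schur a) (\<lambda>i. v (Suc i)) =
     (\<Sum>i<n. \<Sum>j<n. v (Suc i) * v (Suc j) * a (Suc i) (Suc j) -
        (v (Suc i) * a 0 (Suc i)) * (v (Suc j) * a 0 (Suc j)) / a 0 0)"
    unfolding quad_form_def schur_def
    by (intro sum.cong refl) (simp add: col0 algebra_simps)
  also have "\<dots> = quad_form n (\<lambda>i j. a (Suc i) (Suc j)) (\<lambda>i. v (Suc i)) - S * S / a 0 0"
    unfolding S_def sum_product sum_divide_distrib quad_form_def by (simp add: sum_subtractf)
  finally show ?thesis
    using nz unfolding quad_form_Suc[OF sym] S_def[symmetric]
    by (simp add: power2_eq_square) (simp add: field_simps)
qed

lemma schur_symmetric:
  assumes "symm (Suc n) a"
  shows "symm n (schur a)"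
  using assms by (simp add: symm_def schur_def)

lemma fdet_schur: "a 0 0 \<noteq> 0 \<Longrightarrow> fdet (Suc n) a = a 0 0 * fdet n (schur a)"
  unfolding schur_def by (rule fdet_pivot)

lemma quad_form_unit: "m < n \<Longrightarrow> quad_form n a (\<lambda>i. if i = m then 1 else 0) = a m m"
proof -
  assume m: "m < n"
  have "(\<Sum>j<n. (if i = m then 1 else 0) * (if j = m then 1 else 0) * a i j) =
      (if i = m then a m m else 0)" for i
    using m by (cases "i = m") (simp_all add: if_distrib[of "\<lambda>x. x * _"] cong: if_cong)
  then show "quad_form n a (\<lambda>i. if i = m then 1 else 0) = a m m"
    using m by (simp add: quad_form_def)
qed

lemma psd_diag: "psd n a \<Longrightarrow> m < n \<Longrightarrow> 0 \<le> a m m"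
  using quad_form_unit[of m n a] unfolding psd_def by metis

lemma psd_two:
  assumes sym: "symm n a" and psd: "psd n a"
    and km: "k < n" "m < n"
  shows "(a k m)\<^sup>2 \<le> a k k * a m m"
proof (cases "k = m")
  case False
  have quad: "0 \<le> x * x * a k k + 2 * x * y * a k m + y * y * a m m" for x y
  proof -
    define v where "v = (\<lambda>i. if i = k then x else if i = m then y else 0)"
    have inner: "(\<Sum>j<n. v i * v j * a i j) = v i * x * a i k + v i * y * a i m" for i
    proof -
      have "(\<Sum>j<n. v i * v j * a i j) = (\<Sum>j\<in>{k, m}. v i * v j * a i j)"
        by (rule sum.mono_neutral_right) (use km in \<open>auto simp: v_def\<close>)
      then show ?thesis using False by (simp add: v_def)
    qed
    have "quad_form n a v = (\<Sum>i\<in>{k, m}. v i * x * a i k + v i * y * a i m)"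
      unfolding quad_form_def inner by (rule sum.mono_neutral_right) (use km in \<open>auto simp: v_def\<close>)
    also have "\<dots> = x * x * a k k + 2 * x * y * a k m + y * y * a m m"
      using False sym km by (simp add: v_def symm_def algebra_simps)
    finally show ?thesis using psd unfolding psd_def by metis
  qed
  have mm: "0 \<le> a m m" by (rule psd_diag[OF psd km(2)])
  show ?thesis
  proof (cases "a m m = 0")
    case True
    have "a k m = 0"
    proof (rule ccontr)
      assume nz: "a k m \<noteq> 0"
      define y where "y = - (a k k + 1) / (2 * a k m)"
      have "a k k + 2 * y * a k m = -1" using nz by (simp add: y_def field_simps)
      with quad[of 1 y] True show False by simp
    qed
    then show ?thesis using True by simp
  next
    case False
    with mm have pos: "0 < a m m" by simp
    have "0 \<le> a m m * (a k k * a m m - (a k m)\<^sup>2)"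
      using quad[of "a m m" "- a k m"] by (simp add: algebra_simps power2_eq_square)
    then show ?thesis using pos by (simp add: zero_le_mult_iff)
  qed
qed (simp add: power2_eq_square)

text \<open>Not only the leading minors are needed, as the corner entry may vanish. If it does, the 2 by 2
minors force the first row to vanish, and it can be dropped. Otherwise the principal minors of the
Schur complement are, up to the corner entry, the principal minors of \<open>a\<close> that contain
the first index.\<close>

lemma psd_of_principal_minors:
  assumes "symm n a"
    and "\<And>k f. strict_mono_on {..<k} f \<Longrightarrow> f ` {..<k} \<subseteq> {..<n} \<Longrightarrow> 0 \<le> fdet k (\<lambda>i j. a (f i) (f j))"
  shows "psd n a"
  using assms
proof (induction n arbitrary: a)
  case 0
  then show ?case by (simp add: psd_def quad_form_def)
next
  case (Suc n)
  note sym = Suc.prems(1)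
  have a00: "0 \<le> a 0 0"
  proof -
    have "strict_mono_on {..<Suc 0} (\<lambda>_. 0 :: nat)" by (auto simp: strict_mono_on_def)
    from Suc.prems(2)[OF this] show ?thesis by (simp add: fdet_1 image_subset_iff)
  qed
  show ?case
  proof (cases "a 0 0 = 0")
    case True
    have row0: "a 0 (Suc i) = 0" if "i < n" for i
    proof -
      define f where "f = (\<lambda>l::nat. if l = 0 then 0 else Suc i)"
      have "0 \<le> fdet 2 (\<lambda>i j. a (f i) (f j))"
        by (rule Suc.prems(2)) (use that in \<open>auto simp: f_def strict_mono_on_def\<close>)
      also have "fdet 2 (\<lambda>i j. a (f i) (f j)) = - (a 0 (Suc i))\<^sup>2"
        using True sym that by (simp add: fdet_2 f_def symm_def power2_eq_square)
      finally show ?thesis by simp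
    qed
    have "psd n (\<lambda>i j. a (Suc i) (Suc j))"
    proof (rule Suc.IH)
      fix k :: nat and f :: "nat \<Rightarrow> nat" assume "strict_mono_on {..<k} f" "f ` {..<k} \<subseteq> {..<n}"
      then show "0 \<le> fdet k (\<lambda>i j. a (Suc (f i)) (Suc (f j)))"
        using Suc.prems(2)[of k "\<lambda>i. Suc (f i)"] by (auto simp: strict_mono_on_def)
    qed (use sym in \<open>auto simp: symm_def\<close>)
    then show ?thesis
      unfolding psd_def by (simp add: quad_form_Suc[OF sym] True row0)
  next
    case False
    have "psd n (schur a)"
    proof (rule Suc.IH)
      fix k :: nat and f :: "nat \<Rightarrow> nat" assume f: "strict_mono_on {..<k} f" "f ` {..<k} \<subseteq> {..<n}"
      define g where "g = case_nat 0 (\<lambda>i. Suc (f i))"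
      have "0 \<le> fdet (Suc k) (\<lambda>i j. a (g i) (g j))"
        by (rule Suc.prems(2))
           (use f in \<open>auto simp: g_def strict_mono_on_def image_subset_iff split: nat.splits\<close>)
      also have "fdet (Suc k) (\<lambda>i j. a (g i) (g j)) = a 0 0 * fdet k (\<lambda>i j. schur a (f i) (f j))"
        using False by (subst fdet_pivot) (simp_all add: g_def schur_def)
      finally show "0 \<le> fdet k (\<lambda>i j. schur a (f i) (f j))"
        using False a00 by (simp add: zero_le_mult_iff)
    qed (rule schur_symmetric[OF sym])
    then show ?thesis
      using a00 unfolding psd_def by (simp add: quad_form_schur[OF sym False])
  qed
qed

lemma fdet_pos_of_pos_def:
  assumes "symm n a" "pos_def n a"
  shows "0 < fdet n a"
  using assms
proof (induction n arbitrary: a)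
  case (Suc n)
  note sym = Suc.prems(1)
  have "0 < quad_form (Suc n) a (\<lambda>i. if i = 0 then 1 else 0)"
    using Suc.prems(2) unfolding pos_def_def by auto
  then have a00: "0 < a 0 0" by (simp add: quad_form_unit)
  have "pos_def n (schur a)"
    unfolding pos_def_def
  proof (intro allI impI)
    fix v :: "nat \<Rightarrow> real" assume v: "\<exists>i<n. v i \<noteq> 0"
    \<comment> \<open>the leading entry that annihilates the completed square\<close>
    define w where "w = case_nat (- (\<Sum>i<n. v i * a 0 (Suc i)) / a 0 0) v"
    obtain i where "Suc i < Suc n" "w (Suc i) \<noteq> 0" using v by (auto simp: w_def)
    then have "0 < quad_form (Suc n) a w"
      using Suc.prems(2) unfolding pos_def_def by blast
    then show "0 < quad_form n (schur a) v"
      using a00 by (simp add: quad_form_schur[OF sym] w_def)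
  qed
  then have "0 < fdet n (schur a)"
    using Suc.IH schur_symmetric[OF sym] by blast
  then show ?case using a00 by (simp add: fdet_schur)
qed simp

lemma psd_gram:
  assumes "symm n a" "psd n a"
  shows "\<exists>u. \<forall>i<n. \<forall>j<n. a i j = (\<Sum>k<n. u k i * u k j)"
  using assms
proof (induction n arbitrary: a)
  case (Suc n)
  note sym = Suc.prems(1)
  have a00: "0 \<le> a 0 0" using psd_diag[OF Suc.prems(2)] by simp
  \<comment> \<open>if the corner entry is 0, then so is the first row, and division by 0 gives the vector 0\<close>
  define w where "w = (\<lambda>i. a 0 i / sqrt (a 0 0))"
  define b where "b = (\<lambda>i j. a (Suc i) (Suc j) - w (Suc i) * w (Suc j))"
  have col0: "a (Suc i) 0 = a 0 (Suc i)" if "i < n" for i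
    using sym that by (simp add: symm_def)
  have row0: "a 0 i = 0" if "a 0 0 = 0" "i \<le> n" for i
    using psd_two[OF Suc.prems, of 0 i] that by simp
  have "psd n b"
  proof (cases "a 0 0 = 0")
    case True
    then have "quad_form n b v = quad_form (Suc n) a (case_nat 0 v)" for v
      unfolding quad_form_Suc[OF sym] by (simp add: b_def w_def)
    then show ?thesis using Suc.prems(2) by (simp add: psd_def)
  next
    case False
    then have "quad_form n b v = quad_form n (schur a) v" for v
      by (intro quad_form_cong) (use a00 col0 in \<open>auto simp: b_def w_def schur_def\<close>)
    also have "quad_form n (schur a) v = quad_form (Suc n) a (case_nat (- (\<Sum>i<n. v i * a 0 (Suc i)) / a 0 0) v)" for v
      using False by (simp add: quad_form_schur[OF sym])
    finally show ?thesis using Suc.prems(2) by (simp add: psd_def)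
  qed
  moreover have "symm n b"
    using sym by (simp add: b_def symm_def)
  ultimately obtain u where u: "\<forall>i<n. \<forall>j<n. b i j = (\<Sum>k<n. u k i * u k j)"
    using Suc.IH by blast
  define u' where "u' = (\<lambda>k i. case k of 0 \<Rightarrow> w i | Suc k' \<Rightarrow> (case i of 0 \<Rightarrow> 0 | Suc i' \<Rightarrow> u k' i'))"
  have w0: "w 0 * w i = a 0 i" if "i \<le> n" for i
    using a00 row0[OF _ that] by (cases "a 0 0 = 0") (auto simp: w_def)
  have "a i j = (\<Sum>k<Suc n. u' k i * u' k j)" if "i < Suc n" "j < Suc n" for i j
  proof -
    have "(\<Sum>k<Suc n. u' k i * u' k j) = w i * w j +
        (\<Sum>k<n. (case i of 0 \<Rightarrow> 0 | Suc i' \<Rightarrow> u k i') * (case j of 0 \<Rightarrow> 0 | Suc j' \<Rightarrow> u k j'))"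
      unfolding sum.lessThan_Suc_shift by (simp add: u'_def)
    also have "\<dots> = a i j"
    proof (cases i)
      case 0
      then show ?thesis using w0[of j] that by simp
    next
      case (Suc i')
      show ?thesis
      proof (cases j)
        case 0
        then show ?thesis using w0[of i] col0[of i'] Suc that by (simp add: mult.commute)
      next
        case (Suc j')
        have "b i' j' = (\<Sum>k<n. u k i' * u k j')" using u that \<open>i = Suc i'\<close> Suc by simp
        then show ?thesis using \<open>i = Suc i'\<close> Suc by (simp add: b_def algebra_simps)
      qed
    qed
    finally show ?thesis by simp
  qed
  then show ?case by blast
qed simp

text \<open>The Schur product theorem: by a Gram representation of \<open>a\<close>, the form of the entrywise
product is a sum of values of the form of \<open>b\<close>.\<close>

lemma psd_schur_product:
  assumes "symm n a" "psd n a" "psd n b"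
  shows "psd n (\<lambda>i j. a i j * b i j)"
proof -
  obtain u where u: "\<forall>i<n. \<forall>j<n. a i j = (\<Sum>k<n. u k i * u k j)"
    using psd_gram[OF assms(1,2)] by blast
  have "quad_form n (\<lambda>i j. a i j * b i j) v = (\<Sum>k<n. quad_form n b (\<lambda>i. u k i * v i))" for v
  proof -
    have "quad_form n (\<lambda>i j. a i j * b i j) v =
        (\<Sum>i<n. \<Sum>j<n. \<Sum>k<n. (u k i * v i) * (u k j * v j) * b i j)"
      unfolding quad_form_def using u
      by (intro sum.cong refl) (simp add: sum_distrib_left sum_distrib_right algebra_simps)
    also have "\<dots> = (\<Sum>i<n. \<Sum>k<n. \<Sum>j<n. (u k i * v i) * (u k j * v j) * b i j)"
      by (intro sum.cong refl sum.swap)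
    also have "\<dots> = (\<Sum>k<n. quad_form n b (\<lambda>i. u k i * v i))"
      unfolding quad_form_def by (rule sum.swap)
    finally show ?thesis .
  qed
  then show ?thesis using assms(3) by (simp add: psd_def sum_nonneg)
qed

lemma psd_power:
  assumes "symm n a" "psd n a"
  shows "psd n (\<lambda>i j. a i j ^ m)"
proof (induction m)
  case 0
  have "quad_form n (\<lambda>i j. 1) v = (\<Sum>i<n. v i)\<^sup>2" for v
    by (simp add: quad_form_def power2_eq_square sum_product)
  then show ?case by (simp add: psd_def)
next
  case (Suc m)
  then show ?case using psd_schur_product[OF assms] by simp
qed

lemma psd_power_series:
  assumes "symm n a" "psd n a" "\<And>m. 0 \<le> c m"
    and sums: "\<And>i j. i < n \<Longrightarrow> j < n \<Longrightarrow> (\<lambda>m. c m * a i j ^ m) sums b i j"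
  shows "psd n b"
  unfolding psd_def
proof
  fix v
  have "(\<lambda>m. \<Sum>i<n. \<Sum>j<n. v i * v j * (c m * a i j ^ m)) sums quad_form n b v"
    unfolding quad_form_def by (intro sums_sum sums_mult sums) auto
  moreover have "(\<Sum>i<n. \<Sum>j<n. v i * v j * (c m * a i j ^ m)) = c m * quad_form n (\<lambda>i j. a i j ^ m) v" for m
    unfolding quad_form_def sum_distrib_left by (intro sum.cong refl) (simp add: algebra_simps)
  ultimately have "(\<lambda>m. c m * quad_form n (\<lambda>i j. a i j ^ m) v) sums quad_form n b v" by simp
  then show "0 \<le> quad_form n b v"
  proof (rule sums_le[OF _ sums_zero, rotated])
    show "0 \<le> c m * quad_form n (\<lambda>i j. a i j ^ m) v" for m
      using psd_power[OF assms(1,2)] assms(3) by (simp add: psd_def)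
  qed
qed


section \<open>Positivity of all minors from contiguous minors\<close>

text \<open>Multilinearity in the rows writes the determinant as a sum of determinants with one row chosen from
each interval. The intervals are disjoint and increasing, so that only increasing choices occur.\<close>

lemma fdet_row_intervals_pos:
  fixes f :: "nat \<Rightarrow> nat"
  assumes pos: "\<And>g. (\<And>i. i < k \<Longrightarrow> f i \<le> g i \<and> g i < f (Suc i)) \<Longrightarrow> 0 < fdet k (\<lambda>i j. c (g i) j)"
    and f: "\<And>i. i < k \<Longrightarrow> f i < f (Suc i)"
  shows "0 < fdet k (\<lambda>i j. \<Sum>l = f i..<f (Suc i). c l j)"
proof -
  define S where "S = (\<lambda>i j. \<Sum>l = f i..<f (Suc i). c l j)"
  have "0 < fdet k (\<lambda>i j. if i < m then S i j else c (g i) j)"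
    if "m \<le> k" "\<And>i. i < k \<Longrightarrow> f i \<le> g i \<and> g i < f (Suc i)" for m g
    using that
  proof (induction m arbitrary: g)
    case 0
    then show ?case using pos by simp
  next
    case (Suc m)
    have "fdet k (\<lambda>i j. if i < Suc m then S i j else c (g i) j) =
      fdet k (\<lambda>i j. if i = m then (\<Sum>l = f m..<f (Suc m). c l j)
        else if i < m then S i j else c (g i) j)"
      by (rule fdet_cong) (auto simp: S_def)
    also have "\<dots> = (\<Sum>l = f m..<f (Suc m).
        fdet k (\<lambda>i j. if i = m then c l j else if i < m then S i j else c (g i) j))"
      by (rule fdet_row_sum) (use Suc.prems in auto)
    also have "\<dots> = (\<Sum>l = f m..<f (Suc m).
        fdet k (\<lambda>i j. if i < m then S i j else c ((g(m := l)) i) j))"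
      by (intro sum.cong refl fdet_cong) auto
    also have "\<dots> > 0"
    proof (rule sum_pos)
      show "{f m..<f (Suc m)} \<noteq> {}" using f[of m] Suc.prems by simp
      fix l assume "l \<in> {f m..<f (Suc m)}"
      then show "0 < fdet k (\<lambda>i j. if i < m then S i j else c ((g(m := l)) i) j)"
        by (intro Suc.IH) (use Suc.prems in auto)
    qed simp
    finally show ?case .
  qed
  from this[of k f] have "0 < fdet k (\<lambda>i j. if i < k then S i j else c (f i) j)"
    using f by simp
  also have "\<dots> = fdet k S" by (rule fdet_cong) simp
  finally show ?thesis by (simp add: S_def)
qed

text \<open>Dividing each row by its first entry turns the first column into ones, and subtracting from each row
its predecessor then clears that column.\<close>

lemma fdet_divided_differences:
  assumes "\<And>i. i \<le> k \<Longrightarrow> r (f i) 0 \<noteq> 0"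
  shows "fdet (Suc k) (\<lambda>i j. r (f i) j) = (\<Prod>i<Suc k. r (f i) 0) *
    fdet k (\<lambda>i j. r (f (Suc i)) (Suc j) / r (f (Suc i)) 0 - r (f i) (Suc j) / r (f i) 0)"
proof -
  define b where "b = (\<lambda>i j. r (f i) j / r (f i) 0)"
  define d where "d = (\<lambda>i j. case i of 0 \<Rightarrow> b 0 j | Suc i' \<Rightarrow> b (Suc i') j - b i' j)"
  have telescope: "(\<Sum>l\<le>i. d l j) = b i j" for i j
    by (induction i) (auto simp: d_def)
  have "fdet (Suc k) (\<lambda>i j. r (f i) j) = (\<Prod>i<Suc k. r (f i) 0) * fdet (Suc k) d"
  proof (rule fdet_lower_triangular_factor[where m = "\<lambda>i l. r (f i) 0"])
    fix i j assume "i < Suc k" "j < Suc k"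
    then show "r (f i) j = (\<Sum>l\<le>i. r (f i) 0 * d l j)"
      using assms[of i] unfolding sum_distrib_left[symmetric] telescope by (simp add: b_def)
  qed
  also have "fdet (Suc k) d = d 0 0 * fdet k (\<lambda>i j. d (Suc i) (Suc j))"
    by (rule fdet_first_column_zero) (use assms in \<open>simp add: d_def b_def\<close>)
  finally show ?thesis using assms[of 0] by (simp add: d_def b_def)
qed

text \<open>Fekete's principle, with the columns fixed and only the rows varying. It is a discrete form of the
fact that positive Wronskians make a Chebyshev system, and it is proved in the same way: the
differences \<open>c\<close> of consecutive normalised rows form a system with one column less,
whose contiguous minors are again positive. The differences of the normalised rows with indices
\<open>f i\<close> and \<open>f (i + 1)\<close> are sums of rows of \<open>c\<close> over disjoint
intervals.\<close>

lemma fdet_rows_pos_of_contiguous: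
  assumes "\<And>p q. q \<le> k \<Longrightarrow> p + q \<le> n \<Longrightarrow> 0 < fdet q (\<lambda>i j. r (p + i) j)"
    and "strict_mono_on {..<k} f" "f ` {..<k} \<subseteq> {..<n}"
  shows "0 < fdet k (\<lambda>i j. r (f i) j)"
  using assms
proof (induction k arbitrary: r n f)
  case (Suc k)
  have f_less: "f i < n" if "i \<le> k" for i
    using Suc.prems(3) that by (auto simp: image_subset_iff)
  have f_mono: "f i < f j" if "i < j" "j \<le> k" for i j
    using Suc.prems(2) that by (auto simp: strict_mono_on_def)
  have n: "n \<ge> 1" using f_less[of 0] by simp
  have pos: "0 < r p 0" if "p < n" for p
    using Suc.prems(1)[of "Suc 0" p] that by (simp add: fdet_1)
  define c where "c = (\<lambda>l j. r (Suc l) (Suc j) / r (Suc l) 0 - r l (Suc j) / r l 0)"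
  have contiguous_c: "0 < fdet q (\<lambda>i j. c (p + i) j)" if "q \<le> k" "p + q \<le> n - 1" for p q
  proof -
    have "0 < fdet (Suc q) (\<lambda>i j. r (p + i) j)"
      using Suc.prems(1)[of "Suc q" p] that n by simp
    also have "\<dots> = (\<Prod>i<Suc q. r (p + i) 0) * fdet q (\<lambda>i j. c (p + i) j)"
      unfolding c_def add_Suc_right[symmetric]
    proof (rule fdet_divided_differences[where f = "\<lambda>i. p + i"])
      fix i assume "i \<le> q"
      then have "p + i < n" using that n by linarith
      then show "r (p + i) 0 \<noteq> 0" using pos[of "p + i"] by simp
    qed
    finally have "0 < (\<Prod>i<Suc q. r (p + i) 0) * fdet q (\<lambda>i j. c (p + i) j)" .
    moreover have "0 < (\<Prod>i<Suc q. r (p + i) 0)"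
      by (rule prod_pos) (use pos that n in auto)
    ultimately show ?thesis by (simp only: zero_less_mult_pos)
  qed
  have "0 < fdet k (\<lambda>i j. \<Sum>l = f i..<f (Suc i). c l j)"
  proof (rule fdet_row_intervals_pos)
    fix g assume g: "\<And>i. i < k \<Longrightarrow> f i \<le> g i \<and> g i < f (Suc i)"
    show "0 < fdet k (\<lambda>i j. c (g i) j)"
    proof (rule Suc.IH[OF contiguous_c])
      show "strict_mono_on {..<k} g"
      proof (rule strict_mono_onI)
        fix i j assume "i \<in> {..<k}" "j \<in> {..<k}" "i < j"
        then have "g i < f (Suc i)" "f (Suc i) \<le> f j" "f j \<le> g j"
          using g f_mono[of "Suc i" j] by (simp_all, cases "Suc i = j") auto
        then show "g i < g j" by simp
      qed
      show "g ` {..<k} \<subseteq> {..<n - 1}"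
      proof (rule image_subsetI)
        fix i assume "i \<in> {..<k}"
        then have "g i < f (Suc i)" "f (Suc i) < n" using g f_less[of "Suc i"] by auto
        then show "g i \<in> {..<n - 1}" by simp
      qed
    qed
  qed (use f_mono in auto)
  also have "fdet k (\<lambda>i j. \<Sum>l = f i..<f (Suc i). c l j) =
      fdet k (\<lambda>i j. r (f (Suc i)) (Suc j) / r (f (Suc i)) 0 - r (f i) (Suc j) / r (f i) 0)"
  proof (rule fdet_cong)
    fix i j assume "i < k"
    then have "f i \<le> f (Suc i)" using f_mono[of i "Suc i"] by simp
    then show "(\<Sum>l = f i..<f (Suc i). c l j) =
        r (f (Suc i)) (Suc j) / r (f (Suc i)) 0 - r (f i) (Suc j) / r (f i) 0"
      unfolding c_def by (rule sum_Suc_diff'[where f = "\<lambda>l. r l (Suc j) / r l 0"])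
  qed
  finally have differences_pos: "0 < \<dots>" .
  have "0 < (\<Prod>i<Suc k. r (f i) 0)"
    by (rule prod_pos) (use pos f_less in auto)
  note mult_pos_pos[OF this differences_pos]
  also have "(\<Prod>i<Suc k. r (f i) 0) *
      fdet k (\<lambda>i j. r (f (Suc i)) (Suc j) / r (f (Suc i)) 0 - r (f i) (Suc j) / r (f i) 0) =
      fdet (Suc k) (\<lambda>i j. r (f i) j)"
  proof (rule fdet_divided_differences[symmetric])
    fix i assume "i \<le> k"
    then have "f i < n" by (rule f_less)
    from pos[OF this] show "r (f i) 0 \<noteq> 0" by simp
  qed
  finally show ?case .
qed simp


section \<open>Totally non-negative Hankel matrices\<close>

text \<open>The shift \<open>d\<close> is a parameter because total non-negativity concerns the shifts 0 and 1
together.\<close>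

definition hankel :: "(nat \<Rightarrow> real) \<Rightarrow> nat \<Rightarrow> nat \<Rightarrow> nat \<Rightarrow> real" where
  "hankel s d = (\<lambda>i j. s (d + i + j))"

lemma symm_hankel [simp]: "symm n (hankel s d)"
  by (simp add: symm_def hankel_def algebra_simps)
lemma pos_def_block:
  assumes "pos_def n a" "p + q \<le> n"
  shows "pos_def q (\<lambda>i j. a (p + i) (p + j))"
  unfolding pos_def_def
proof (intro allI impI)
  fix v :: "nat \<Rightarrow> real" assume "\<exists>i<q. v i \<noteq> 0"
  then obtain i where i: "i < q" "v i \<noteq> 0" by blast
  define w where "w = (\<lambda>i. if p \<le> i \<and> i < p + q then v (i - p) else 0)"
  have restrict: "(\<Sum>i<n. w i * h i) = (\<Sum>i<q. v i * h (p + i))" for h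
  proof -
    have "(\<Sum>i<n. w i * h i) = (\<Sum>i = p..<p + q. w i * h i)"
      by (rule sum.mono_neutral_right) (use assms(2) in \<open>auto simp: w_def\<close>)
    also have "\<dots> = (\<Sum>i<q. w (p + i) * h (p + i))"
      using sum.shift_bounds_nat_ivl[of "\<lambda>i. w i * h i" 0 p q]
      by (simp add: atLeast0LessThan add.commute)
    finally show ?thesis by (simp add: w_def)
  qed
  have "quad_form n a w = (\<Sum>i<n. w i * (\<Sum>j<n. w j * a i j))"
    unfolding quad_form_def sum_distrib_left by (simp add: mult.assoc)
  also have "\<dots> = quad_form q (\<lambda>i j. a (p + i) (p + j)) v"
    unfolding restrict by (simp add: quad_form_def sum_distrib_left mult.assoc)
  finally have "quad_form n a w = \<dots>" .
  moreover have "w (p + i) \<noteq> 0" "p + i < n" using i assms(2) by (auto simp: w_def)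
  ultimately show "0 < quad_form q (\<lambda>i j. a (p + i) (p + j)) v"
    using assms(1) unfolding pos_def_def by metis
qed

text \<open>A contiguous minor of a Hankel matrix depends only on the sum of its first row and column indices,
so it can be moved to the diagonal of the matrix itself or of its shift, according to the parity of
that sum.\<close>

lemma hankel_contiguous_minor_pos:
  assumes "pos_def n (hankel s 0)" "pos_def (n - 1) (hankel s 1)" "p + q \<le> n" "c + q \<le> n"
  shows "0 < fdet q (\<lambda>i j. s ((p + i) + (c + j)))"
proof (cases "even (p + c)")
  case True
  then obtain e where e: "p + c = 2 * e" by blast
  have "pos_def q (\<lambda>i j. hankel s 0 (e + i) (e + j))"
    by (rule pos_def_block[OF assms(1)]) (use assms(3,4) e in linarith)
  then have "0 < fdet q (\<lambda>i j. hankel s 0 (e + i) (e + j))"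
    by (rule fdet_pos_of_pos_def[rotated]) (simp add: symm_def hankel_def algebra_simps)
  also have "\<dots> = fdet q (\<lambda>i j. s ((p + i) + (c + j)))"
    by (intro fdet_cong) (use e in \<open>simp add: hankel_def, intro arg_cong[where f = s], simp\<close>)
  finally show ?thesis .
next
  case False
  then obtain e where e: "p + c = 2 * e + 1" using oddE by blast
  have "pos_def q (\<lambda>i j. hankel s 1 (e + i) (e + j))"
    by (rule pos_def_block[OF assms(2)]) (use assms(3,4) e in linarith)
  then have "0 < fdet q (\<lambda>i j. hankel s 1 (e + i) (e + j))"
    by (rule fdet_pos_of_pos_def[rotated]) (simp add: symm_def hankel_def algebra_simps)
  also have "\<dots> = fdet q (\<lambda>i j. s ((p + i) + (c + j)))"
    by (intro fdet_cong) (use e in \<open>simp add: hankel_def, intro arg_cong[where f = s], simp\<close>)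
  finally show ?thesis .
qed

text \<open>Fekete's principle is used twice, once for the rows of minors with contiguous columns, and then,
after transposing, for the columns of minors with arbitrary rows.\<close>

lemma hankel_minor_pos:
  assumes "pos_def n (hankel s 0)" "pos_def (n - 1) (hankel s 1)"
    and f: "strict_mono_on {..<k} f" "f ` {..<k} \<subseteq> {..<n}"
    and g: "strict_mono_on {..<k} g" "g ` {..<k} \<subseteq> {..<n}"
  shows "0 < fdet k (\<lambda>i j. s (f i + g j))"
proof -
  have contiguous_columns: "0 < fdet q (\<lambda>i j. s (f i + (c + j)))" if "q \<le> k" "c + q \<le> n" for c q
  proof (rule fdet_rows_pos_of_contiguous[where r = "\<lambda>p j. s (p + (c + j))" and n = n])
    fix p q' assume "q' \<le> q" "p + q' \<le> n"
    then show "0 < fdet q' (\<lambda>i j. s (p + i + (c + j)))"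
      using that by (intro hankel_contiguous_minor_pos[OF assms(1,2)]) auto
  qed (use f that in \<open>auto simp: strict_mono_on_def image_subset_iff\<close>)
  have "0 < fdet k (\<lambda>i j. s (f j + g i))"
  proof (rule fdet_rows_pos_of_contiguous[where r = "\<lambda>p j. s (f j + p)" and n = n])
    fix p q assume "q \<le> k" "p + q \<le> n"
    then show "0 < fdet q (\<lambda>i j. s (f j + (p + i)))"
      using contiguous_columns[of q p] fdet_transpose[of q "\<lambda>i j. s (f i + (p + j))"] by simp
  qed (use g in auto)
  then show ?thesis using fdet_transpose[of k "\<lambda>i j. s (f i + g j)"] by simp
qed

text \<open>The moments of the counting measure on \<open>{1..n}\<close>. They serve as the perturbation that
makes the Hankel matrices positive definite: a non-zero polynomial of degree less than
\<open>n\<close> cannot vanish at all \<open>n\<close> points.\<close>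

definition power_sum :: "nat \<Rightarrow> nat \<Rightarrow> real" where
  "power_sum n m = (\<Sum>a = 1..n. real a ^ m)"

lemma quad_form_power_sum:
  "quad_form q (hankel (power_sum n) d) v = (\<Sum>a = 1..n. real a ^ d * (\<Sum>i<q. v i * real a ^ i)\<^sup>2)"
proof -
  have "quad_form q (hankel (power_sum n) d) v =
      (\<Sum>i<q. \<Sum>j<q. \<Sum>a = 1..n. real a ^ d * ((v i * real a ^ i) * (v j * real a ^ j)))"
    unfolding quad_form_def hankel_def power_sum_def sum_distrib_left
    by (intro sum.cong refl) (simp add: power_add algebra_simps)
  also have "\<dots> = (\<Sum>i<q. \<Sum>a = 1..n. \<Sum>j<q. real a ^ d * ((v i * real a ^ i) * (v j * real a ^ j)))"
    by (intro sum.cong refl sum.swap)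
  also have "\<dots> = (\<Sum>a = 1..n. \<Sum>i<q. \<Sum>j<q. real a ^ d * ((v i * real a ^ i) * (v j * real a ^ j)))"
    by (rule sum.swap)
  also have "\<dots> = (\<Sum>a = 1..n. real a ^ d * (\<Sum>i<q. v i * real a ^ i)\<^sup>2)"
    unfolding power2_eq_square sum_product unfolding sum_distrib_left by simp
  finally show ?thesis .
qed

lemma pos_def_power_sum:
  assumes "q \<le> n"
  shows "pos_def q (hankel (power_sum n) d)"
  unfolding pos_def_def
proof (intro allI impI)
  fix v :: "nat \<Rightarrow> real" assume "\<exists>i<q. v i \<noteq> 0"
  then obtain i where i: "i < q" "v i \<noteq> 0" by blast
  define Z where "Z = {z. (\<Sum>i\<le>q - 1. v i * z ^ i) = 0}"
  have Z: "finite Z" "card Z \<le> q - 1"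
    unfolding Z_def using polyfun_rootbound[of "q - 1" v] i by fastforce+
  have upto: "{..q - 1} = {..<q}" using i by auto
  have "\<exists>a\<in>{1..n}. real a \<notin> Z"
  proof (rule ccontr)
    assume "\<not> ?thesis"
    then have "real ` {1..n} \<subseteq> Z" by auto
    then have "card (real ` {1..n}) \<le> card Z" by (rule card_mono[OF Z(1)])
    moreover have "card (real ` {1..n}) = n" by (subst card_image) auto
    ultimately show False using Z(2) assms i by simp
  qed
  then obtain a where a: "a \<in> {1..n}" "(\<Sum>i<q. v i * real a ^ i) \<noteq> 0"
    unfolding Z_def upto by auto
  show "0 < quad_form q (hankel (power_sum n) d) v"
    unfolding quad_form_power_sum
    by (rule sum_pos2[of _ a]) (use a in auto)
qed

lemma hankel_minor_nonneg:
  assumes psd: "psd n (hankel s 0)" "psd (n - 1) (hankel s 1)"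
    and f: "strict_mono_on {..<k} f" "f ` {..<k} \<subseteq> {..<n}"
    and g: "strict_mono_on {..<k} g" "g ` {..<k} \<subseteq> {..<n}"
  shows "0 \<le> fdet k (\<lambda>i j. s (f i + g j))"
proof -
  define t where "t = (\<lambda>e m. s m + e * power_sum n m)"
  have pos_def_t: "pos_def q (hankel (t e) d)" if "psd q (hankel s d)" "q \<le> n" "e > 0" for e q d
    unfolding pos_def_def
  proof (intro allI impI)
    fix v :: "nat \<Rightarrow> real" assume v: "\<exists>i<q. v i \<noteq> 0"
    have "quad_form q (hankel (t e) d) v = quad_form q (hankel s d) v + e * quad_form q (hankel (power_sum n) d) v"
      by (simp add: quad_form_def hankel_def t_def sum.distrib sum_distrib_left algebra_simps)
    moreover have "0 < quad_form q (hankel (power_sum n) d) v"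
      using pos_def_power_sum[OF that(2)] v unfolding pos_def_def by blast
    ultimately show "0 < quad_form q (hankel (t e) d) v"
      using that unfolding psd_def by (simp add: add_nonneg_pos)
  qed
  \<comment> \<open>the minor depends continuously on the size \<open>e\<close> of the perturbation\<close>
  have "((\<lambda>e. fdet k (\<lambda>i j. t e (f i + g j))) \<longlongrightarrow> fdet k (\<lambda>i j. t 0 (f i + g j))) (at_right 0)"
    unfolding t_def by (intro tendsto_fdet tendsto_intros)
  moreover have "0 \<le> fdet k (\<lambda>i j. t e (f i + g j))" if "e > 0" for e
    by (rule less_imp_le, rule hankel_minor_pos[OF pos_def_t pos_def_t f g]) (use psd that in auto)
  then have "\<forall>\<^sub>F e in at_right 0. 0 \<le> fdet k (\<lambda>i j. t e (f i + g j))"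
    by (simp add: eventually_at_right_less eventually_mono[OF eventually_at_right_less])
  ultimately have "0 \<le> fdet k (\<lambda>i j. t 0 (f i + g j))"
    by (rule tendsto_lowerbound) simp
  then show ?thesis by (simp add: t_def)
qed

lemma pick_strict_mono_image:
  assumes f: "strict_mono_on {..<k} f" and "i < k"
  shows "pick (f ` {..<k}) i = f i"
proof -
  have inj: "inj_on f {..<k}" using f by (rule strict_mono_on_imp_inj_on)
  have "{a \<in> f ` {..<k}. a < f i} = f ` {..<i}"
    using assms strict_mono_on_less[OF f] by auto
  moreover have "card (f ` {..<i}) = i"
    by (subst card_image) (use inj assms(2) in \<open>auto intro: inj_on_subset\<close>)
  ultimately show ?thesis
    using pick_card_in_set[of "f i" "f ` {..<k}"] assms(2) by auto
qed

text \<open>Removing the first column and the last row of the Hankel matrix leaves the matrix of the shifted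
sequence, whose principal minors are therefore minors of the original matrix. This gives one
direction; the other is \<open>hankel_minor_nonneg\<close>.\<close>

lemma totally_nonneg_hankel_iff:
  "totally_nonneg_mat (hankel_mat n s) \<longleftrightarrow> psd n (hankel s 0) \<and> psd (n - 1) (hankel s 1)"
proof
  assume tn: "totally_nonneg_mat (hankel_mat n s)"
  have minor: "0 \<le> fdet k (\<lambda>i j. s (f i + g j))"
    if f: "strict_mono_on {..<k} f" "f ` {..<k} \<subseteq> {..<n}"
      and g: "strict_mono_on {..<k} g" "g ` {..<k} \<subseteq> {..<n}" for k f g
  proof -
    let ?I = "f ` {..<k}" and ?J = "g ` {..<k}"
    have card: "card ?I = k" "card ?J = k"
      using card_image[OF strict_mono_on_imp_inj_on[OF f(1)]]
        card_image[OF strict_mono_on_imp_inj_on[OF g(1)]] by auto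
    have inside: "{i. i < n \<and> i \<in> ?I} = ?I" "{i. i < n \<and> i \<in> ?J} = ?J"
      using f(2) g(2) by auto
    have "submatrix (hankel_mat n s) ?I ?J = Matrix.mat k k (\<lambda>(i, j). s (f i + g j))"
      unfolding submatrix_def
      by (rule eq_matI)
         (use f g in \<open>auto simp: hankel_mat_def inside card pick_strict_mono_image image_subset_iff\<close>)
    moreover have "0 \<le> Determinant.det (submatrix (hankel_mat n s) ?I ?J)"
      using tn f(2) g(2) card unfolding totally_nonneg_mat_def by (simp add: hankel_mat_def)
    ultimately show ?thesis by (simp add: fdet_def)
  qed
  have "psd n (hankel s 0)"
    using minor by (intro psd_of_principal_minors[OF symm_hankel]) (simp add: hankel_def)
  moreover have "psd (n - 1) (hankel s 1)"
  proof (rule psd_of_principal_minors)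
    fix k :: nat and f :: "nat \<Rightarrow> nat"
    assume f: "strict_mono_on {..<k} f" "f ` {..<k} \<subseteq> {..<n - 1}"
    have "0 \<le> fdet k (\<lambda>i j. s (f i + Suc (f j)))"
      by (rule minor) (use f in \<open>force simp: strict_mono_on_def image_subset_iff\<close>)+
    then show "0 \<le> fdet k (\<lambda>i j. hankel s 1 (f i) (f j))" by (simp add: hankel_def)
  qed simp
  ultimately show "psd n (hankel s 0) \<and> psd (n - 1) (hankel s 1)" ..
next
  assume psd: "psd n (hankel s 0) \<and> psd (n - 1) (hankel s 1)"
  show "totally_nonneg_mat (hankel_mat n s)"
    unfolding totally_nonneg_mat_def
  proof (intro allI impI)
    fix I J
    assume "I \<subseteq> {..<dim_row (hankel_mat n s)} \<and> J \<subseteq> {..<dim_col (hankel_mat n s)} \<and> card I = card J"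
    then have I: "I \<subseteq> {..<n}" and J: "J \<subseteq> {..<n}" and card: "card J = card I"
      by (auto simp: hankel_mat_def)
    have inside: "{i. i < n \<and> i \<in> I} = I" "{i. i < n \<and> i \<in> J} = J"
      using I J by auto
    have less_n: "pick I i < n" "pick J i < n" if "i < card I" for i
      using I J card that pick_in_set_le[of i I] pick_in_set_le[of i J] by auto
    have "submatrix (hankel_mat n s) I J =
        Matrix.mat (card I) (card I) (\<lambda>(i, j). s (pick I i + pick J j))"
      unfolding submatrix_def
      by (rule eq_matI) (use less_n in \<open>auto simp: hankel_mat_def inside card\<close>)
    moreover have "0 \<le> fdet (card I) (\<lambda>i j. s (pick I i + pick J j))"
      by (rule hankel_minor_nonneg) (use psd less_n card in \<open>auto intro!: strict_mono_onI pick_mono_le\<close>)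
    ultimately show "0 \<le> Determinant.det (submatrix (hankel_mat n s) I J)"
      by (simp add: fdet_def)
  qed
qed

lemma tn_hankel_iff:
  "A \<in> tn_hankel \<longleftrightarrow>
    (\<exists>n s. 1 \<le> n \<and> A = hankel_mat n s \<and> psd n (hankel s 0) \<and> psd (n - 1) (hankel s 1))"
  unfolding tn_hankel_def tn_hankel_dim_def
  using totally_nonneg_hankel_iff by fastforce

lemma psd_mat_hankel_iff: "psd_mat (hankel_mat n s) \<longleftrightarrow> psd n (hankel s 0)"
proof -
  have sq: "square_mat (hankel_mat n s)" "transpose_mat (hankel_mat n s) = hankel_mat n s"
    by (auto simp: hankel_mat_def add.commute)
  have form: "Matrix.scalar_prod w (hankel_mat n s *\<^sub>v w) = quad_form n (hankel s 0) (\<lambda>i. w $ i)"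
    if "w \<in> carrier_vec n" for w
    using that by (simp add: scalar_prod_def hankel_mat_def quad_form_def hankel_def atLeast0LessThan
        sum_distrib_left algebra_simps)
  show ?thesis
  proof
    assume A: "psd_mat (hankel_mat n s)"
    show "psd n (hankel s 0)"
      unfolding psd_def
    proof
      fix v
      have "quad_form n (hankel s 0) v = quad_form n (hankel s 0) (\<lambda>i. Matrix.vec n v $ i)"
        by (rule quad_form_cong) auto
      also have "\<dots> = Matrix.scalar_prod (Matrix.vec n v) (hankel_mat n s *\<^sub>v Matrix.vec n v)"
        by (rule form[symmetric]) simp
      also have "\<dots> \<ge> 0"
        using A unfolding psd_mat_def by (simp add: hankel_mat_def)
      finally show "0 \<le> quad_form n (hankel s 0) v" .
    qed
  next
    assume "psd n (hankel s 0)"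
    then show "psd_mat (hankel_mat n s)"
      using sq form unfolding psd_mat_def psd_def by (simp add: hankel_mat_def)
  qed
qed

lemma map_mat_hankel: "map_mat F (hankel_mat n s) = hankel_mat n (\<lambda>m. F (s m))"
  by (rule eq_matI) (auto simp: hankel_mat_def)

section \<open>Entrywise functions tested on two-atom measures\<close>

definition fdiff :: "real \<Rightarrow> (real \<Rightarrow> real) \<Rightarrow> real \<Rightarrow> real" where
  "fdiff h f = (\<lambda>x. f (x + h) - f x)"

text \<open>The consequence that the preservation properties have in common: \<open>F\<close> is only applied to
the moments of the measures \<open>a \<delta>\<^sub>x + b \<delta>\<^sub>y\<close>.\<close>

definition two_atom_psd :: "(real \<Rightarrow> real) \<Rightarrow> bool" where
  "two_atom_psd F \<longleftrightarrow> (\<forall>a\<ge>0. \<forall>b\<ge>0. \<forall>x\<ge>0. \<forall>y\<ge>0. \<forall>n.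
     psd n (hankel (\<lambda>m. F (a * x ^ m + b * y ^ m)) 0))"

lemma two_atom_psdD:
  assumes "two_atom_psd F" "0 \<le> a" "0 \<le> b" "0 \<le> x" "0 \<le> y"
  shows "psd n (hankel (\<lambda>m. F (a * x ^ m + b * y ^ m)) 0)"
  using assms unfolding two_atom_psd_def by blast

lemma two_atom_nonneg:
  assumes "two_atom_psd F" "0 \<le> a"
  shows "0 \<le> F a"
  using psd_diag[OF two_atom_psdD[OF assms(1), of a 0 1 1 1], of 0] assms(2) by (simp add: hankel_def)

lemma two_atom_mono:
  assumes "two_atom_psd F" "0 \<le> a" "a \<le> b"
  shows "F a \<le> F b"
proof -
  \<comment> \<open>the masses \<open>a\<close> at 1 and \<open>b - a\<close> at 0 have the moments \<open>b, a, a, \<dots>\<close>\<close>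
  have "(F a)\<^sup>2 \<le> F b * F a"
    using psd_two[OF symm_hankel two_atom_psdD[OF assms(1), of a "b - a" 1 0 2], of 0 1] assms(2,3)
    by (simp add: hankel_def)
  then show ?thesis
    using two_atom_nonneg[OF assms(1), of a] two_atom_nonneg[OF assms(1), of b] assms(2,3)
    by (cases "F a = 0") (auto simp: power2_eq_square)
qed

lemma two_atom_geometric:
  assumes "two_atom_psd F" "0 < x" "0 < y"
  shows "(F (sqrt (x * y)))\<^sup>2 \<le> F x * F y"
proof -
  have "x * sqrt (y / x) = sqrt (x * y)"
    using assms(2,3) by (simp add: real_sqrt_divide real_sqrt_mult field_simps)
  moreover have "x * (sqrt (y / x))\<^sup>2 = y" using assms(2,3) by simp
  ultimately show ?thesis
    using psd_two[OF symm_hankel two_atom_psdD[OF assms(1), of x 0 "sqrt (y / x)" 1 2], of 0 1] assms(2,3)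
    by (simp add: hankel_def numeral_2_eq_2[symmetric] del: power_Suc)
qed

text \<open>An increasing function can only fail to be continuous by a jump from \<open>l\<close> to
\<open>u\<close>. For a point \<open>x\<close> slightly to the left of \<open>c\<close> and
\<open>y\<close> to its right the geometric mean can be made to exceed \<open>c\<close>, so that
\<open>u\<^sup>2 \<le> F x * F y\<close>, and in the limit \<open>u\<^sup>2 \<le> l u\<close>.\<close>

lemma two_atom_isCont:
  assumes F: "two_atom_psd F" and c: "0 < c"
  shows "isCont F c"
proof -
  define l u where "l = Sup (F ` {0<..<c})" and "u = Inf (F ` {c<..})"
  have mono: "F x \<le> F y" if "0 < x" "x \<le> y" for x y
    using two_atom_mono[OF F, of x y] that by simp
  have nonneg: "0 \<le> F x" if "0 < x" for x
    using two_atom_nonneg[OF F, of x] that by simp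
  have left_ne: "F ` {0<..<c} \<noteq> {}" and right_ne: "F ` {c<..} \<noteq> {}"
    using c dense[of 0 c] by (auto simp: image_is_empty)
  have left_bdd: "bdd_above (F ` {0<..<c})"
    by (rule bdd_aboveI[of _ "F c"]) (use mono in auto)
  have right_bdd: "bdd_below (F ` {c<..})"
    by (rule bdd_belowI[of _ "F c"]) (use mono c in auto)
  have F_le_l: "F x \<le> l" if "0 < x" "x < c" for x
    unfolding l_def using left_bdd that by (intro cSup_upper) auto
  have u_le_F: "u \<le> F y" if "c < y" for y
    unfolding u_def using right_bdd that by (intro cInf_lower) auto
  have l_le: "l \<le> F c" unfolding l_def using left_ne mono by (intro cSup_least) auto
  have u_ge: "F c \<le> u" unfolding u_def using right_ne mono c by (intro cInf_greatest) auto
  have "u * u \<le> l * F y" if y: "c < y" for y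
  proof -
    \<comment> \<open>choose \<open>x\<close> so close to \<open>c\<close> that \<open>c\<^sup>2 < x y\<close>\<close>
    have "c * c / y < c" using y c by (simp add: field_simps)
    then obtain x where x: "c * c / y < x" "x < c" using dense by blast
    have x0: "0 < x" using x(1) y c by (smt (verit) divide_nonneg_pos mult_nonneg_nonneg)
    have "c * c < x * y" using x y c by (simp add: field_simps)
    then have "c < sqrt (x * y)" using c by (intro real_less_rsqrt) (simp add: power2_eq_square)
    then have "u \<le> F (sqrt (x * y))" by (rule u_le_F)
    moreover have "0 \<le> u" using u_ge nonneg[OF c] by simp
    ultimately have "u * u \<le> (F (sqrt (x * y)))\<^sup>2"
      by (simp add: power2_eq_square mult_mono)
    also have "\<dots> \<le> F x * F y" using two_atom_geometric[OF F x0] y c by simp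
    also have "\<dots> \<le> l * F y"
      using F_le_l[OF x0 x(2)] nonneg y c by (intro mult_right_mono) auto
    finally show ?thesis .
  qed
  note square_le = this
  have "u \<le> l"
  proof (rule ccontr)
    assume "\<not> u \<le> l"
    moreover have "0 \<le> l" using F_le_l[of "c / 2"] nonneg[of "c / 2"] c by simp
    ultimately have "0 \<le> l" "l < u" by auto
    have "u * u \<le> l * u"
    proof (cases "l = 0")
      case True
      then show ?thesis using square_le[of "c + 1"] by simp
    next
      case False
      then have "0 < l" using \<open>0 \<le> l\<close> by simp
      then have "u * u / l \<le> F y" if "c < y" for y
        using square_le[OF that] by (simp add: field_simps)
      then have "\<And>z. z \<in> F ` {c<..} \<Longrightarrow> u * u / l \<le> z" by auto
      then have "u * u / l \<le> u"
        using cInf_greatest[OF right_ne, folded u_def] by blast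
      then show ?thesis using \<open>0 < l\<close> by (simp add: field_simps)
    qed
    then show False using \<open>0 \<le> l\<close> \<open>l < u\<close> by (smt (verit) mult_right_mono mult_less_cancel_right)
  qed
  then have eq: "l = F c" "u = F c" using l_le u_ge by auto
  show ?thesis
    unfolding isCont_def LIM_eq
  proof (intro allI impI)
    fix e :: real assume e: "0 < e"
    have "\<exists>x\<in>{0<..<c}. F c - e < F x"
      using less_cSup_iff[OF left_ne left_bdd, of "F c - e"] e eq(1) unfolding l_def by auto
    then obtain x where x: "0 < x" "x < c" "F c - e < F x" by auto
    have "\<exists>y\<in>{c<..}. F y < F c + e"
      using cInf_less_iff[OF right_ne right_bdd, of "F c + e"] e eq(2) unfolding u_def by auto
    then obtain y where y: "c < y" "F y < F c + e" by auto
    have "norm (F z - F c) < e" if "norm (z - c) < min (c - x) (y - c)" for z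
    proof -
      have "x \<le> z" "z \<le> y" "0 < z" using that x by (auto simp: abs_less_iff)
      then show ?thesis using mono[of x z] mono[of z y] x y by (simp add: abs_less_iff)
    qed
    then show "\<exists>d>0. \<forall>z. z \<noteq> c \<and> norm (z - c) < d \<longrightarrow> norm (F z - F c) < e"
      using x y by (intro exI[of _ "min (c - x) (y - c)"]) auto
  qed
qed

text \<open>Take the coefficients of the polynomial with the roots \<open>1, q, \<dots>, q\<^sup>(N-1)\<close>.\<close>

lemma loewner_test_vector:
  fixes q :: real
  assumes "0 < q" "q < 1"
  shows "\<exists>v. (\<forall>k<N. (\<Sum>i<Suc N. v i * (q ^ k) ^ i) = 0) \<and> (\<Sum>i<Suc N. v i * (q ^ N) ^ i) \<noteq> 0"
proof -
  define V where "V = (\<Prod>k<N. [:- (q ^ k), 1:])"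
  have "degree V = N"
    unfolding V_def by (subst degree_prod_eq_sum_degree) auto
  then have eval: "(\<Sum>i<Suc N. coeff V i * x ^ i) = poly V x" for x
    by (simp add: poly_altdef lessThan_Suc_atMost)
  have "poly V x = (\<Prod>k<N. x - q ^ k)" for x
    by (simp add: V_def poly_prod)
  moreover have "q ^ N \<noteq> q ^ k" if "k < N" for k
    using power_strict_decreasing[OF that assms] by simp
  ultimately show ?thesis
    unfolding eval[symmetric] by (intro exI[of _ "coeff V"]) (auto simp: eval)
qed

text \<open>The argument of Horn and Loewner. In the quadratic form of the test vector, the Taylor term of order
\<open>k\<close> is multiplied by the square \<open>W k\<close> of a value of its polynomial at
\<open>q\<^sup>k\<close>. This vanishes for \<open>k < N\<close>, so what remains is of order
\<open>t\<^sup>N\<close> with the coefficient \<open>D N a * W N / N!\<close>.\<close>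

lemma loewner_derivative_nonneg:
  fixes D :: "nat \<Rightarrow> real \<Rightarrow> real"
  assumes q: "0 < q" "q < 1" and a: "0 < a"
    and deriv: "\<And>m x. m < N \<Longrightarrow> 0 < x \<Longrightarrow> (D m has_real_derivative D (Suc m) x) (at x)"
    and cont: "isCont (D N) a"
    and psd: "\<And>t. 0 \<le> t \<Longrightarrow> psd (Suc N) (hankel (\<lambda>m. D 0 (a + t * q ^ m)) 0)"
  shows "0 \<le> D N a"
proof -
  obtain v where v: "\<And>k. k < N \<Longrightarrow> (\<Sum>i<Suc N. v i * (q ^ k) ^ i) = 0"
      "(\<Sum>i<Suc N. v i * (q ^ N) ^ i) \<noteq> 0"
    using loewner_test_vector[OF q, of N] by blast
  define W where "W = (\<lambda>k. (\<Sum>i<Suc N. v i * (q ^ k) ^ i)\<^sup>2)"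
  have W: "W k = (\<Sum>i<Suc N. \<Sum>j<Suc N. v i * v j * (q ^ (i + j)) ^ k)" for k
    unfolding W_def power2_eq_square sum_product
    by (intro sum.cong refl) (simp add: power_add power_mult_distrib power_mult[symmetric] mult_ac)
  have W_vanishes: "W k = 0" if "k < N" for k
    unfolding W_def v(1)[OF that] by simp
  have WN: "0 < W N" using v(2) by (simp add: W_def)
  have form: "0 \<le> (\<Sum>i<Suc N. \<Sum>j<Suc N. v i * v j * D 0 (a + t * q ^ (i + j)))" if "0 \<le> t" for t
    using psd[OF that] unfolding psd_def quad_form_def hankel_def by simp
  show ?thesis
  proof (cases "N = 0")
    case True
    then have "0 \<le> (v 0)\<^sup>2 * D 0 a" "v 0 \<noteq> 0"
      using form[of 0] v(2) by (simp_all add: power2_eq_square)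
    then show ?thesis using True by (simp add: zero_le_mult_iff)
  next
    case False
    define P where "P = (\<lambda>t m \<tau>. a < \<tau> \<and> \<tau> < a + t * q ^ m \<and> D 0 (a + t * q ^ m) =
        (\<Sum>k<N. D k a / fact k * (t * q ^ m) ^ k) + D N \<tau> / fact N * (t * q ^ m) ^ N)"
    have "\<exists>\<tau>. P t m \<tau>" if "0 < t" for t m
    proof -
      have "\<exists>\<tau>>a. \<tau> < a + t * q ^ m \<and> D 0 (a + t * q ^ m) =
          (\<Sum>k<N. D k a / fact k * (a + t * q ^ m - a) ^ k) +
          D N \<tau> / fact N * (a + t * q ^ m - a) ^ N"
        using that q a False by (intro Taylor_up[where a = a]) (auto intro!: deriv)
      then show ?thesis by (simp add: P_def)
    qed
    note expansion_point = this
    define \<tau> where "\<tau> = (\<lambda>t m. SOME \<tau>. P t m \<tau>)"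
    have \<tau>: "P t m (\<tau> t m)" if "0 < t" for t m
      unfolding \<tau>_def by (rule someI_ex[OF expansion_point[OF that]])
    note \<tau> = this[unfolded P_def]
    define R where "R = (\<lambda>t. \<Sum>i<Suc N. \<Sum>j<Suc N. v i * v j * (D N (\<tau> t (i + j)) * (q ^ (i + j)) ^ N))"
    have R_nonneg: "0 \<le> R t" if t: "0 < t" for t
    proof -
      have expand: "D 0 (a + t * q ^ m) = (\<Sum>k<N. D k a / fact k * t ^ k * (q ^ m) ^ k)
          + t ^ N / fact N * (D N (\<tau> t m) * (q ^ m) ^ N)" for m
      proof -
        have "D 0 (a + t * q ^ m) = (\<Sum>k<N. D k a / fact k * (t * q ^ m) ^ k)
            + D N (\<tau> t m) / fact N * (t * q ^ m) ^ N"
          using \<tau>[OF t, of m] by blast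
        also have "\<dots> = (\<Sum>k<N. D k a / fact k * t ^ k * (q ^ m) ^ k)
            + t ^ N / fact N * (D N (\<tau> t m) * (q ^ m) ^ N)"
          unfolding power_mult_distrib by (simp add: mult_ac)
        finally show ?thesis .
      qed
      have "(\<Sum>i<Suc N. \<Sum>j<Suc N. v i * v j * D 0 (a + t * q ^ (i + j))) =
        (\<Sum>i<Suc N. \<Sum>j<Suc N. (\<Sum>k<N. D k a / fact k * t ^ k * (v i * v j * (q ^ (i + j)) ^ k))
          + t ^ N / fact N * (v i * v j * (D N (\<tau> t (i + j)) * (q ^ (i + j)) ^ N)))"
        unfolding expand distrib_left sum_distrib_left by (simp only: mult_ac)
      also have "\<dots> = (\<Sum>i<Suc N. \<Sum>j<Suc N. \<Sum>k<N. D k a / fact k * t ^ k * (v i * v j * (q ^ (i + j)) ^ k))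
          + t ^ N / fact N * R t"
        unfolding R_def sum_distrib_left sum.distrib by simp
      also have "(\<Sum>i<Suc N. \<Sum>j<Suc N. \<Sum>k<N. D k a / fact k * t ^ k * (v i * v j * (q ^ (i + j)) ^ k))
          = (\<Sum>i<Suc N. \<Sum>k<N. \<Sum>j<Suc N. D k a / fact k * t ^ k * (v i * v j * (q ^ (i + j)) ^ k))"
        by (intro sum.cong refl sum.swap)
      also have "\<dots> = (\<Sum>k<N. \<Sum>i<Suc N. \<Sum>j<Suc N. D k a / fact k * t ^ k * (v i * v j * (q ^ (i + j)) ^ k))"
        by (rule sum.swap)
      also have "\<dots> = (\<Sum>k<N. D k a / fact k * t ^ k * W k)"
        unfolding W sum_distrib_left by simp
      also have "\<dots> = 0" using W_vanishes by (intro sum.neutral) simp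
      finally have "0 \<le> t ^ N / fact N * R t" using form[of t] t by simp
      moreover have "0 < t ^ N / fact N" using t by simp
      ultimately show ?thesis using mult_pos_neg[of "t ^ N / fact N" "R t"] by linarith
    qed
    have "((\<lambda>t. D N (\<tau> t m)) \<longlongrightarrow> D N a) (at_right 0)" for m
    proof (rule isCont_tendsto_compose[OF cont])
      show "((\<lambda>t. \<tau> t m) \<longlongrightarrow> a) (at_right 0)"
      proof (rule tendsto_sandwich[of "\<lambda>_. a" _ _ "\<lambda>t. a + t * q ^ m"])
        show "\<forall>\<^sub>F t in at_right 0. a \<le> \<tau> t m" "\<forall>\<^sub>F t in at_right 0. \<tau> t m \<le> a + t * q ^ m"
          using eventually_at_right_less[of "0::real"]
          by (auto elim!: eventually_mono dest!: \<tau>[of _ m] intro: less_imp_le)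
        have "((\<lambda>t. a + t * q ^ m) \<longlongrightarrow> a + 0 * q ^ m) (at_right 0)"
          by (intro tendsto_intros)
        then show "((\<lambda>t. a + t * q ^ m) \<longlongrightarrow> a) (at_right 0)" by simp
      qed simp
    qed
    then have "(R \<longlongrightarrow> (\<Sum>i<Suc N. \<Sum>j<Suc N. v i * v j * (D N a * (q ^ (i + j)) ^ N))) (at_right 0)"
      unfolding R_def by (intro tendsto_intros)
    moreover have "\<forall>\<^sub>F t in at_right 0. 0 \<le> R t"
      using eventually_at_right_less[of "0::real"] by (rule eventually_mono) (rule R_nonneg)
    ultimately have "0 \<le> (\<Sum>i<Suc N. \<Sum>j<Suc N. v i * v j * (D N a * (q ^ (i + j)) ^ N))"
      by (rule tendsto_lowerbound) simp
    also have "\<dots> = D N a * W N"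
      unfolding W sum_distrib_left by (intro sum.cong refl) (simp add: algebra_simps)
    finally show ?thesis using WN by (simp add: zero_le_mult_iff)
  qed
qed

lemma fdiff_iter_deriv:
  assumes "0 \<le> h" "\<And>x. 0 < x \<Longrightarrow> (f has_real_derivative g x) (at x)" "0 < x"
  shows "((fdiff h ^^ k) f has_real_derivative (fdiff h ^^ k) g x) (at x)"
  using assms(3)
proof (induction k arbitrary: x)
  case (Suc k)
  have "((\<lambda>x. (fdiff h ^^ k) f (x + h)) has_real_derivative (fdiff h ^^ k) g (x + h)) (at x)"
    unfolding DERIV_shift[symmetric] using Suc assms(1) by simp
  then show ?case
    unfolding funpow.simps o_def fdiff_def[of h "(fdiff h ^^ k) _"]
    using Suc by (intro derivative_intros) auto
qed (use assms in simp)

lemma fdiff_iter_isCont: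
  assumes "0 \<le> h" "\<And>x. 0 < x \<Longrightarrow> isCont f x" "0 < x"
  shows "isCont ((fdiff h ^^ k) f) x"
  using assms(3)
proof (induction k arbitrary: x)
  case (Suc k)
  have "isCont (\<lambda>x. (fdiff h ^^ k) f (x + h)) x"
    by (rule isCont_o2[where f = "\<lambda>x. x + h"]) (use Suc assms(1) in \<open>auto intro!: continuous_intros\<close>)
  then show ?case
    unfolding funpow.simps o_def fdiff_def[of h "(fdiff h ^^ k) _"]
    using Suc by (intro continuous_intros) auto
qed (use assms in simp)

text \<open>The \<open>k\<close>-th difference of a \<open>k\<close>-fold primitive \<open>G k\<close> of
\<open>F\<close> is a \<open>k\<close>-fold integral of translates of \<open>F\<close>, so it
satisfies the same inequalities as \<open>F\<close>. In the induction this is expressed through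
derivatives: the quadratic form of the next primitive has a non-negative derivative with respect to
the base point \<open>b\<close>, so its difference is non-negative. For \<open>k = N\<close> the
function is smooth enough for the argument of Horn and Loewner.\<close>

lemma two_atom_fdiff_nonneg:
  assumes F: "two_atom_psd F" and h: "0 < h" and a: "0 < a"
  shows "0 \<le> (fdiff h ^^ N) F a"
proof -
  have "\<exists>g. \<forall>x>0. (g has_real_derivative f x) (at x)"
    if "\<And>x. 0 < x \<Longrightarrow> isCont f x" for f :: "real \<Rightarrow> real"
  proof -
    have "\<exists>g. \<forall>x. 0 < ereal x \<longrightarrow> ereal x < \<infinity> \<longrightarrow> (g has_vector_derivative f x) (at x)"
      by (rule einterval_antiderivative) (use that in \<open>auto simp: zero_ereal_def\<close>)
    then show ?thesis
      by (auto simp: has_real_derivative_iff_has_vector_derivative zero_ereal_def)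
  qed
  then have "\<forall>f :: real \<Rightarrow> real. \<exists>g. (\<forall>x>0. isCont f x) \<longrightarrow> (\<forall>x>0. (g has_real_derivative f x) (at x))"
    by blast
  then obtain prim :: "(real \<Rightarrow> real) \<Rightarrow> real \<Rightarrow> real" where prim:
      "\<And>f x. (\<And>x. 0 < x \<Longrightarrow> isCont f x) \<Longrightarrow> 0 < x \<Longrightarrow> (prim f has_real_derivative f x) (at x)"
    by metis
  \<comment> \<open>\<open>G k\<close> is a \<open>k\<close>-fold primitive of \<open>F\<close> on the positive half-line\<close>
  define G where "G = (\<lambda>k. (prim ^^ k) F)"
  have G_cont: "isCont (G k) x" if "0 < x" for k x
    using that
  proof (induction k arbitrary: x)
    case 0
    then show ?case using two_atom_isCont[OF F] by (simp add: G_def)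
  next
    case (Suc k)
    then show ?case using prim[of "G k" x] DERIV_isCont by (fastforce simp: G_def)
  qed
  have G_deriv: "(G (Suc k) has_real_derivative G k x) (at x)" if "0 < x" for k x
    using prim[of "G k", OF G_cont that] by (simp add: G_def)
  have form: "0 \<le> (\<Sum>i<n. \<Sum>j<n. v i * v j * (fdiff h ^^ k) (G k) (b + t * (1/2) ^ (i + j)))"
    if "0 < b" "0 \<le> t" for k n v b t
    using that(1)
  proof (induction k arbitrary: b)
    case 0
    have "psd n (hankel (\<lambda>m. F (b * 1 ^ m + t * (1/2) ^ m)) 0)"
      by (rule two_atom_psdD[OF F]) (use 0 that in auto)
    then show ?case by (simp add: psd_def quad_form_def hankel_def G_def)
  next
    case (Suc k)
    define \<phi> where "\<phi> = (\<lambda>y. \<Sum>i<n. \<Sum>j<n. v i * v j * (fdiff h ^^ k) (G (Suc k)) (y + t * (1/2) ^ (i + j)))"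
    define \<phi>' where "\<phi>' = (\<lambda>y. \<Sum>i<n. \<Sum>j<n. v i * v j * (fdiff h ^^ k) (G k) (y + t * (1/2) ^ (i + j)))"
    have "(\<phi> has_real_derivative \<phi>' y) (at y)" if y: "0 < y" for y
    proof -
      have "((\<lambda>y. (fdiff h ^^ k) (G (Suc k)) (y + c)) has_real_derivative (fdiff h ^^ k) (G k) (y + c)) (at y)"
        if "0 \<le> c" for c
        unfolding DERIV_shift[symmetric]
        using fdiff_iter_deriv[of h "G (Suc k)" "G k" "y + c" k] G_deriv h y that by simp
      then show ?thesis
        unfolding \<phi>_def \<phi>'_def using \<open>0 \<le> t\<close> by (intro DERIV_sum DERIV_cmult) auto
    qed
    moreover have "0 \<le> \<phi>' y" if "0 < y" for y
      using Suc.IH[OF that] by (simp add: \<phi>'_def)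
    ultimately have deriv_nonneg: "\<exists>y. (\<phi> has_real_derivative y) (at x) \<and> 0 \<le> y" if "b \<le> x" for x
      using Suc.prems that by (intro exI[of _ "\<phi>' x"]) auto
    have "\<phi> b \<le> \<phi> (b + h)"
    proof (rule DERIV_nonneg_imp_nondecreasing[where f = \<phi>])
      show "b \<le> b + h" using h by simp
      show "\<exists>y. (\<phi> has_real_derivative y) (at x) \<and> 0 \<le> y" if "b \<le> x" "x \<le> b + h" for x
        using that(1) by (rule deriv_nonneg)
    qed
    moreover have "\<phi> (b + h) - \<phi> b =
        (\<Sum>i<n. \<Sum>j<n. v i * v j * (fdiff h ^^ Suc k) (G (Suc k)) (b + t * (1/2) ^ (i + j)))"
      unfolding \<phi>_def funpow.simps o_def fdiff_def[of h "(fdiff h ^^ k) _"]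
        right_diff_distrib sum_subtractf
      by (simp only: add_ac)
    ultimately show ?case by simp
  qed
  define D where "D = (\<lambda>m. (fdiff h ^^ N) (G (N - m)))"
  have "0 \<le> D N a"
  proof (rule loewner_derivative_nonneg[where q = "1/2" and D = D])
    fix m x assume "m < N" "0 < (x::real)"
    then show "(D m has_real_derivative D (Suc m) x) (at x)"
      using fdiff_iter_deriv[of h "G (N - m)" "G (N - Suc m)" x N] G_deriv[of _ "N - Suc m"] h
      by (simp add: D_def Suc_diff_Suc)
  next
    show "isCont (D N) a"
      using fdiff_iter_isCont[of h "G 0" a N] G_cont h a by (simp add: D_def)
  next
    fix t :: real assume "0 \<le> t"
    then show "psd (Suc N) (hankel (\<lambda>m. D 0 (a + t * (1/2) ^ m)) 0)"
      using form[OF a] by (simp add: psd_def quad_form_def hankel_def D_def del: sum.lessThan_Suc)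
  qed (use a in auto)
  then show ?thesis by (simp add: D_def G_def)
qed

section \<open>Absolutely monotonic entire functions\<close>

lemma bernstein_sum_Suc:
  fixes f :: "nat \<Rightarrow> real"
  shows "(\<Sum>k\<le>Suc n. f k * Bernstein (Suc n) k x) =
    (1 - x) * (\<Sum>k\<le>n. f k * Bernstein n k x) + x * (\<Sum>k\<le>n. f (Suc k) * Bernstein n k x)"
proof -
  have split: "Bernstein (Suc n) (Suc k) x = x * Bernstein n k x + (1 - x) * Bernstein n (Suc k) x"
    if "k \<le> n" for k
  proof (cases "k = n")
    case False
    with that have "Suc n - Suc k = Suc (n - Suc k)" "n - k = Suc (n - Suc k)" by auto
    then show ?thesis by (simp add: Bernstein_def algebra_simps)
  qed (simp add: Bernstein_def)
  have first: "Bernstein (Suc n) 0 x = (1 - x) * Bernstein n 0 x"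
    by (simp add: Bernstein_def)
  have "(\<Sum>k\<le>Suc n. f k * Bernstein (Suc n) k x) =
      f 0 * Bernstein (Suc n) 0 x + (\<Sum>k\<le>n. f (Suc k) * Bernstein (Suc n) (Suc k) x)"
    by (rule sum.atMost_Suc_shift)
  also have "(\<Sum>k\<le>n. f (Suc k) * Bernstein (Suc n) (Suc k) x) =
      (\<Sum>k\<le>n. x * (f (Suc k) * Bernstein n k x) + (1 - x) * (f (Suc k) * Bernstein n (Suc k) x))"
    by (intro sum.cong refl) (simp add: split algebra_simps)
  also have "f 0 * Bernstein (Suc n) 0 x + \<dots> = x * (\<Sum>k\<le>n. f (Suc k) * Bernstein n k x) +
      (1 - x) * (f 0 * Bernstein n 0 x + (\<Sum>k\<le>n. f (Suc k) * Bernstein n (Suc k) x))"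
    unfolding first sum.distrib sum_distrib_left[symmetric] by (simp add: distrib_left)
  also have "f 0 * Bernstein n 0 x + (\<Sum>k\<le>n. f (Suc k) * Bernstein n (Suc k) x) =
      (\<Sum>k\<le>Suc n. f k * Bernstein n k x)"
    by (rule sum.atMost_Suc_shift[symmetric])
  also have "\<dots> = (\<Sum>k\<le>n. f k * Bernstein n k x)" by (simp add: Bernstein_def)
  finally show ?thesis by simp
qed

text \<open>With \<open>E\<close> the translation by \<open>h\<close> and \<open>\<Delta> = E - 1\<close>, the
sum is the value at \<open>y\<close> of \<open>((1 - x) + x E)\<^sup>n f = (1 + x \<Delta>)\<^sup>n
f\<close>, a polynomial in \<open>x\<close> with non-negative multiples of the differences of
\<open>f\<close> as coefficients. Each induction step splits off one factor \<open>1 + x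
\<Delta>\<close>.\<close>

lemma bernstein_nonneg_coeffs:
  assumes "\<And>k. 0 \<le> (fdiff h ^^ k) f y"
  shows "\<exists>p. (\<forall>i. 0 \<le> coeff p i) \<and> (\<forall>x. (\<Sum>k\<le>n. f (y + real k * h) * Bernstein n k x) = poly p x)"
  using assms
proof (induction n arbitrary: f)
  case 0
  then show ?case using 0[of 0] by (intro exI[of _ "[:f y:]"]) (auto simp: Bernstein_def coeff_pCons split: nat.splits)
next
  case (Suc n)
  have "0 \<le> (fdiff h ^^ k) (fdiff h f) y" for k
    using Suc.prems[of "Suc k"] by (simp only: funpow_Suc_right o_apply)
  then obtain p p' where p: "\<forall>i. 0 \<le> coeff p i" "\<forall>i. 0 \<le> coeff p' i"
      "\<And>x. (\<Sum>k\<le>n. f (y + real k * h) * Bernstein n k x) = poly p x"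
      "\<And>x. (\<Sum>k\<le>n. fdiff h f (y + real k * h) * Bernstein n k x) = poly p' x"
    using Suc.IH[of f] Suc.IH[of "fdiff h f"] Suc.prems by blast
  have "(\<Sum>k\<le>Suc n. f (y + real k * h) * Bernstein (Suc n) k x) = poly (p + pCons 0 p') x" for x
  proof -
    have shift: "(\<Sum>k\<le>n. f (y + real (Suc k) * h) * Bernstein n k x) = poly p x + poly p' x"
      unfolding p(3,4)[symmetric] sum.distrib[symmetric]
      by (intro sum.cong refl) (simp add: fdiff_def algebra_simps)
    show ?thesis
      unfolding bernstein_sum_Suc p(3) shift by (simp add: algebra_simps)
  qed
  moreover have "0 \<le> coeff (p + pCons 0 p') i" for i
    using p(1,2) by (cases i) auto
  ultimately show ?case by blast
qed

lemma fdiff_iter_rescale: "(fdiff h ^^ k) (\<lambda>x. f (R * x)) y = (fdiff (R * h) ^^ k) f (R * y)"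
  by (induction k arbitrary: y) (simp_all add: fdiff_def algebra_simps)

lemma higher_deriv_nonneg_poly:
  fixes p :: "real poly"
  assumes "\<And>i. 0 \<le> coeff p i"
  shows "(deriv ^^ n) (poly (map_poly complex_of_real p)) 0 \<in> \<real>\<^sub>\<ge>\<^sub>0"
proof -
  have "(deriv ^^ n) (poly (map_poly complex_of_real p)) = poly (map_poly complex_of_real ((pderiv ^^ n) p))"
  proof (induction n)
    case (Suc n)
    have "deriv (poly q) = poly (pderiv q)" for q :: "complex poly"
      by (rule ext) (rule DERIV_imp_deriv, rule poly_DERIV)
    moreover have "pderiv (map_poly complex_of_real q) = map_poly complex_of_real (pderiv q)" for q
      by (rule poly_eqI) (simp add: coeff_pderiv coeff_map_poly)
    ultimately show ?case using Suc by simp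
  qed simp
  moreover have "0 \<le> coeff ((pderiv ^^ n) p) i" for i
    by (induction n arbitrary: i) (simp_all add: assms coeff_pderiv)
  ultimately show ?thesis
    by (simp add: poly_0_coeff_0 coeff_map_poly complex_nonneg_Reals_iff)
qed

lemma norm_poly_le_nonneg_coeffs:
  fixes p :: "real poly"
  assumes "\<And>i. 0 \<le> coeff p i" "norm z \<le> r"
  shows "norm (poly (map_poly complex_of_real p) z) \<le> poly p r"
proof -
  have "norm (poly (map_poly complex_of_real p) z) \<le> (\<Sum>i\<le>degree p. norm (of_real (coeff p i) * z ^ i))"
    unfolding poly_altdef by (simp add: degree_map_poly coeff_map_poly sum_norm_le)
  also have "\<dots> \<le> (\<Sum>i\<le>degree p. coeff p i * r ^ i)"
    using assms by (intro sum_mono) (auto simp: norm_mult norm_power intro!: mult_left_mono power_mono)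
  finally show ?thesis by (simp add: poly_altdef)
qed

text \<open>Non-negative coefficients bound the polynomials on a disc by their values at the rightmost point of
the disc, which converge. So the sequence is a normal family, and pointwise convergence on the
half-line identifies the limit of a subsequence there.\<close>

lemma entire_limit_of_nonneg_polys:
  fixes P :: "nat \<Rightarrow> real poly" and f :: "real \<Rightarrow> real"
  assumes coeffs: "\<And>n i. 0 \<le> coeff (P n) i"
    and lim: "\<And>x. 0 \<le> x \<Longrightarrow> (\<lambda>n. poly (P n) x) \<longlonglongrightarrow> f x"
  shows "\<exists>g. abs_monotonic_entire g \<and> (\<forall>x\<ge>0. g (complex_of_real x) = complex_of_real (f x))"
proof -
  define C where "C = (\<lambda>n. poly (map_poly complex_of_real (P n)))"
  have C_holo: "C n holomorphic_on UNIV" for n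
    unfolding C_def by (intro holomorphic_intros)
  have C_of_real: "C n (of_real x) = of_real (poly (P n) x)" for n x
    by (simp add: C_def poly_altdef degree_map_poly coeff_map_poly)
  have bounded: "\<exists>B. \<forall>h\<in>range C. \<forall>z\<in>K. norm (h z) \<le> B" if K: "compact K" for K
  proof -
    obtain r where r: "\<And>z. z \<in> K \<Longrightarrow> norm z \<le> r"
      using compact_imp_bounded[OF K] unfolding bounded_iff by blast
    define r' where "r' = max 0 r"
    have "Bseq (\<lambda>n. poly (P n) r')"
      using lim[of r'] by (intro convergent_imp_Bseq) (auto simp: convergent_def r'_def)
    then obtain B where B: "\<And>n. norm (poly (P n) r') \<le> B" unfolding Bseq_def by blast
    have "norm (C n z) \<le> B" if "z \<in> K" for n z
    proof -
      have "norm z \<le> r'" using r[OF that] by (simp add: r'_def)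
      then have "norm (C n z) \<le> poly (P n) r'"
        unfolding C_def by (rule norm_poly_le_nonneg_coeffs[OF coeffs])
      then show ?thesis using B[of n] by simp
    qed
    then show ?thesis by blast
  qed
  obtain g r where g: "g holomorphic_on UNIV" "strict_mono (r :: nat \<Rightarrow> nat)"
      "\<And>z. z \<in> UNIV \<Longrightarrow> (\<lambda>n. C (r n) z) \<longlonglongrightarrow> g z"
      "\<And>K. compact K \<Longrightarrow> K \<subseteq> UNIV \<Longrightarrow> uniform_limit K (C \<circ> r) g sequentially"
  proof (rule Montel[of UNIV "range C" C])
    show "h holomorphic_on UNIV" if "h \<in> range C" for h using that C_holo by auto
    show "\<exists>B. \<forall>h\<in>range C. \<forall>z\<in>K. norm (h z) \<le> B" if "compact K" "K \<subseteq> UNIV" for K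
      using bounded that by blast
  qed auto
  have "g (of_real x) = of_real (f x)" if "0 \<le> x" for x
  proof (rule LIMSEQ_unique)
    show "(\<lambda>n. C (r n) (of_real x)) \<longlonglongrightarrow> g (of_real x)" by (rule g(3)) simp
    have "(\<lambda>n. poly (P (r n)) x) \<longlonglongrightarrow> f x"
      using LIMSEQ_subseq_LIMSEQ[OF lim[OF that] g(2)] by (simp add: o_def)
    then show "(\<lambda>n. C (r n) (of_real x)) \<longlonglongrightarrow> of_real (f x)"
      unfolding C_of_real by (rule tendsto_of_real)
  qed
  moreover have "(deriv ^^ n) g 0 / fact n \<in> \<real>\<^sub>\<ge>\<^sub>0" for n
  proof -
    have unif: "uniform_limit (ball 0 1) (C \<circ> r) g sequentially"
      by (rule uniform_limit_on_subset[OF g(4) ball_subset_cball]) auto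
    have "(\<lambda>k. (deriv ^^ n) ((C \<circ> r) k) 0) \<longlonglongrightarrow> (deriv ^^ n) g 0"
    proof (rule higher_deriv_complex_uniform_limit[OF unif])
      have "(C \<circ> r) k holomorphic_on ball 0 1" for k
        unfolding o_def by (rule holomorphic_on_subset[OF C_holo]) simp
      then show "\<forall>\<^sub>F k in sequentially. (C \<circ> r) k holomorphic_on ball 0 1" by simp
    qed auto
    moreover have "(deriv ^^ n) ((C \<circ> r) k) 0 \<in> \<real>\<^sub>\<ge>\<^sub>0" for k
      unfolding C_def o_def by (rule higher_deriv_nonneg_poly[OF coeffs])
    ultimately have "(deriv ^^ n) g 0 \<in> \<real>\<^sub>\<ge>\<^sub>0"
      by (rule closed_sequentially[OF closed_nonneg_Reals_complex, rotated])
    moreover have "(fact n :: complex) \<in> \<real>\<^sub>\<ge>\<^sub>0"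
      using nonneg_Reals_of_nat_I[of "fact n"] by (simp only: of_nat_fact)
    ultimately show ?thesis by (rule nonneg_Reals_divide_I)
  qed
  ultimately show ?thesis using g(1) unfolding abs_monotonic_entire_def by blast
qed

lemma abs_monotonic_of_fdiff_nonneg:
  fixes f :: "real \<Rightarrow> real"
  assumes cont: "continuous_on {0..} f"
    and fdiff: "\<And>h k. 0 < h \<Longrightarrow> 0 \<le> (fdiff h ^^ k) f 0"
  shows "\<exists>g. abs_monotonic_entire g \<and> (\<forall>x\<ge>0. g (complex_of_real x) = complex_of_real (f x))"
proof -
  have approx: "\<exists>p. (\<forall>i. 0 \<le> coeff p i) \<and> (\<forall>x\<in>{0..R}. \<bar>f x - poly p x\<bar> < e)"
    if R: "0 < R" and e: "0 < e" for R e :: real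
  proof -
    have "continuous_on {0..1} (\<lambda>x. f (R * x))"
      by (rule continuous_on_compose2[OF cont]) (use R in \<open>auto intro!: continuous_intros\<close>)
    then obtain N where N: "\<And>n x. N \<le> n \<Longrightarrow> x \<in> {0..1} \<Longrightarrow>
        \<bar>f (R * x) - (\<Sum>k\<le>n. f (R * (k / n)) * Bernstein n k x)\<bar> < e"
      using Bernstein_Weierstrass[of "\<lambda>x. f (R * x)" e] e by blast
    define n where "n = Suc N"
    have "0 \<le> (fdiff (1 / n) ^^ k) (\<lambda>x. f (R * x)) 0" for k
      unfolding fdiff_iter_rescale using fdiff[of "R * (1 / n)" k] R by (simp add: n_def)
    then obtain p where p: "\<forall>i. 0 \<le> coeff p i"
        "\<And>x. (\<Sum>k\<le>n. f (R * (0 + real k * (1 / n))) * Bernstein n k x) = poly p x"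
      using bernstein_nonneg_coeffs[of "1 / n" "\<lambda>x. f (R * x)" 0 n] by blast
    \<comment> \<open>undo the rescaling of \<open>[0, R]\<close> to the unit interval\<close>
    define p' where "p' = p \<circ>\<^sub>p [:0, 1 / R:]"
    have "\<bar>f x - poly p' x\<bar> < e" if "x \<in> {0..R}" for x
      using N[of n "x / R"] R that p(2)[of "x / R"]
      by (simp add: p'_def poly_pcompose n_def)
    moreover have "0 \<le> coeff p' i" for i
      using p(1) R by (simp add: p'_def coeff_pcompose_linear)
    ultimately show ?thesis by blast
  qed
  \<comment> \<open>intervals exhausting the half-line, with errors tending to 0\<close>
  have "\<exists>p. (\<forall>i. 0 \<le> coeff p i) \<and> (\<forall>x\<in>{0..real (Suc n)}. \<bar>f x - poly p x\<bar> < 1 / real (Suc n))" for n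
    by (rule approx) auto
  then obtain P where P: "\<And>n i. 0 \<le> coeff (P n) i"
      "\<And>n x. x \<in> {0..real (Suc n)} \<Longrightarrow> \<bar>f x - poly (P n) x\<bar> < 1 / real (Suc n)"
    by metis
  have "(\<lambda>n. poly (P n) x) \<longlonglongrightarrow> f x" if "0 \<le> x" for x
  proof (rule LIM_zero_cancel, rule Lim_null_comparison)
    show "(\<lambda>n. 1 / real (Suc n)) \<longlonglongrightarrow> 0" by (rule LIMSEQ_Suc[OF lim_1_over_n])
    have "norm (poly (P n) x - f x) \<le> 1 / real (Suc n)" if "nat \<lceil>x\<rceil> \<le> n" for n
      using P(2)[of x n] that \<open>0 \<le> x\<close> by (simp add: abs_minus_commute nat_le_iff ceiling_le_iff less_imp_le)
    then show "\<forall>\<^sub>F n in sequentially. norm (poly (P n) x - f x) \<le> 1 / real (Suc n)"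
      unfolding eventually_sequentially by blast
  qed
  then show ?thesis using entire_limit_of_nonneg_polys[of P f] P(1) by blast
qed

text \<open>The differences at 0 are reached by replacing the value of \<open>F\<close> at 0 by the limit from
the right. The function \<open>f\<close> so obtained is continuous on the closed half-line.\<close>

lemma two_atom_psd_imp_abs_monotonic:
  assumes F: "two_atom_psd F"
  shows "(\<exists>g. abs_monotonic_entire g \<and> (\<forall>x>0. complex_of_real (F x) = g (complex_of_real x))) \<and>
    (\<exists>L. (F \<longlongrightarrow> L) (at_right 0) \<and> 0 \<le> F 0 \<and> F 0 \<le> L)"
proof -
  have F0: "F 0 \<le> F x" if "0 < x" for x
    using two_atom_mono[OF F, of 0 x] that by simp
  define L where "L = Inf (F ` {0<..})"
  have bdd: "bdd_below (F ` {0<..})" by (rule bdd_belowI[of _ "F 0"]) (use F0 in auto)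
  have ne: "F ` {0<..} \<noteq> {}" by auto
  have L_le: "L \<le> F x" if "0 < x" for x
    unfolding L_def using bdd that by (intro cInf_lower) auto
  have lim: "(F \<longlongrightarrow> L) (at_right 0)"
  proof (rule decreasing_tendsto)
    show "\<forall>\<^sub>F x in at_right 0. L \<le> F x"
      using eventually_at_right_less[of "0::real"] by (rule eventually_mono) (rule L_le)
  next
    fix u assume "L < u"
    then obtain y where y: "0 < y" "F y < u"
      unfolding L_def using cInf_less_iff[OF ne bdd, of u] by auto
    have "F x < u" if "0 < x" "x < y" for x
      using two_atom_mono[OF F, of x y] that y by simp
    then show "\<forall>\<^sub>F x in at_right 0. F x < u"
      unfolding eventually_at_right_field using y(1) by blast
  qed
  have F0_L: "F 0 \<le> L" unfolding L_def using F0 ne by (intro cInf_greatest) auto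
  define f where "f = (\<lambda>x. if x \<le> 0 then L else F x)"
  have "continuous_on {0..} f"
    unfolding continuous_on_def
  proof
    fix x :: real assume x: "x \<in> {0..}"
    show "(f \<longlongrightarrow> f x) (at x within {0..})"
    proof (cases "x = 0")
      case True
      have "(f \<longlongrightarrow> L) (at_right 0)"
        by (rule Lim_transform_eventually[OF lim])
           (use eventually_at_right_less[of "0::real"] in \<open>auto elim!: eventually_mono simp: f_def\<close>)
      then show ?thesis
        by (simp add: True f_def at_within_Ici_at_right)
    next
      case False
      then have x: "0 < x" using x by simp
      have "(F \<longlongrightarrow> F x) (at x)" using two_atom_isCont[OF F x] by (simp add: isCont_def)
      moreover have "\<forall>\<^sub>F y in at x. F y = f y"
        using order_tendstoD(1)[OF tendsto_ident_at x, of UNIV]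
        by (rule eventually_mono) (simp add: f_def)
      ultimately have "(f \<longlongrightarrow> F x) (at x)"
        by (rule Lim_transform_eventually)
      then show ?thesis using x by (simp add: f_def tendsto_within_subset[of _ _ _ UNIV])
    qed
  qed
  note cont = this
  have "0 \<le> (fdiff h ^^ k) f 0" if h: "0 < h" for h k
  proof -
    have "continuous_on {0..} ((fdiff h ^^ k) f)"
    proof (induction k)
      case (Suc k)
      have "continuous_on {0..} (\<lambda>x. (fdiff h ^^ k) f (x + h))"
        by (rule continuous_on_compose2[OF Suc]) (use h in \<open>auto intro!: continuous_intros\<close>)
      then show ?case
        unfolding funpow.simps o_def fdiff_def[of h "(fdiff h ^^ k) _"]
        using Suc by (intro continuous_intros)
    qed (simp add: cont)
    then have "((fdiff h ^^ k) f \<longlongrightarrow> (fdiff h ^^ k) f 0) (at 0 within {0..})"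
      unfolding continuous_on_def by simp
    then have "((fdiff h ^^ k) f \<longlongrightarrow> (fdiff h ^^ k) f 0) (at_right 0)"
      by (simp only: at_within_Ici_at_right)
    moreover have "(fdiff h ^^ k) f x = (fdiff h ^^ k) F x" if "0 < x" for x
      using that by (induction k arbitrary: x) (use h in \<open>auto simp: f_def fdiff_def\<close>)
    then have "\<forall>\<^sub>F x in at_right 0. 0 \<le> (fdiff h ^^ k) f x"
      using two_atom_fdiff_nonneg[OF F h]
      by (intro eventually_mono[OF eventually_at_right_less[of "0::real"]]) simp
    ultimately show ?thesis by (rule tendsto_lowerbound) simp
  qed
  then obtain g where g: "abs_monotonic_entire g" "\<forall>x\<ge>0. g (of_real x) = of_real (f x)"
    using abs_monotonic_of_fdiff_nonneg[OF cont] by blast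
  have "complex_of_real (F x) = g (complex_of_real x)" if "0 < x" for x
    using g(2) that by (simp add: f_def)
  then show ?thesis using g(1) lim F0_L two_atom_nonneg[OF F, of 0] by auto
qed

section \<open>Sufficiency for totally non-negative Hankel matrices\<close>

lemma power_series_of_abs_monotonic:
  assumes g: "abs_monotonic_entire g" and F: "\<And>x. 0 < x \<Longrightarrow> complex_of_real (F x) = g (complex_of_real x)"
    and lim: "(F \<longlongrightarrow> L) (at_right 0)"
  obtains c where "\<And>n. 0 \<le> c n" "\<And>x. 0 < x \<Longrightarrow> (\<lambda>n. c n * x ^ n) sums F x" "c 0 = L"
proof
  define c where "c = (\<lambda>n. Re ((deriv ^^ n) g 0 / fact n))"
  have coeff: "(deriv ^^ n) g 0 / fact n = complex_of_real (c n)" and c: "0 \<le> c n" for n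
    using g unfolding abs_monotonic_entire_def c_def
    by (auto simp: complex_nonneg_Reals_iff complex_eq_iff)
  show "0 \<le> c n" for n by (rule c)
  have holo: "g holomorphic_on UNIV" using g by (simp add: abs_monotonic_entire_def)
  show "(\<lambda>n. c n * x ^ n) sums F x" if x: "0 < x" for x
  proof -
    have "(\<lambda>n. (deriv ^^ n) g 0 / fact n * (complex_of_real x - 0) ^ n) sums g (complex_of_real x)"
      by (rule holomorphic_power_series[of g 0 "x + 1"])
         (use x holo in \<open>auto intro: holomorphic_on_subset\<close>)
    then have "(\<lambda>n. complex_of_real (c n * x ^ n)) sums complex_of_real (F x)"
      unfolding coeff by (simp add: F[OF x])
    then show ?thesis by (simp only: sums_of_real_iff)
  qed
  have "isCont g 0"
    using holomorphic_on_imp_continuous_on[OF holo] by (simp add: continuous_on_eq_continuous_at)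
  then have "((\<lambda>x. g (complex_of_real x)) \<longlongrightarrow> g 0) (at_right 0)"
    by (rule isCont_tendsto_compose) (auto intro!: tendsto_eq_intros)
  then have "((\<lambda>x. complex_of_real (F x)) \<longlongrightarrow> g 0) (at_right 0)"
    by (rule Lim_transform_eventually)
       (use eventually_at_right_less[of "0::real"] in \<open>auto elim!: eventually_mono simp: F\<close>)
  moreover have "((\<lambda>x. complex_of_real (F x)) \<longlongrightarrow> complex_of_real L) (at_right 0)"
    by (intro tendsto_of_real lim)
  ultimately have "g 0 = complex_of_real L" by (rule tendsto_unique[rotated]) simp
  then show "c 0 = L" using coeff[of 0] by simp
qed

lemma power_series_mono:
  assumes "\<And>n. 0 \<le> c n" "(\<lambda>n. c n * x ^ n) sums s" "0 \<le> (x :: real)"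
  shows "c 0 \<le> s"
  using sum_le_suminf[of "\<lambda>n. c n * x ^ n" "{0}"] assms by (auto simp: sums_iff)

text \<open>The sequence is log-convex: three consecutive terms starting at an even index form a 2 by 2
principal minor of one matrix, and those starting at an odd index one of the other. Hence a zero
propagates in both directions, and stops only short of the two end terms.\<close>

lemma hankel_zero_entries:
  assumes "psd n (hankel s 0)" "psd (n - 1) (hankel s 1)"
    and m: "m \<le> 2 * n - 2" "s m = 0" and n: "2 \<le> n" and k: "1 \<le> k" "k \<le> 2 * n - 3"
  shows "s k = 0"
proof -
  have log_convex: "(s (Suc i))\<^sup>2 \<le> s i * s (Suc (Suc i))" if "Suc (Suc i) \<le> 2 * n - 2" for i
  proof (cases "even i")
    case True
    then obtain e where "i = 2 * e" by blast
    then show ?thesis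
      using psd_two[OF symm_hankel assms(1), of e "Suc e"] that by (simp add: hankel_def mult_2)
  next
    case False
    then obtain e where "i = 2 * e + 1" using oddE by blast
    then show ?thesis
      using psd_two[OF symm_hankel assms(2), of e "Suc e"] that by (simp add: hankel_def mult_2)
  qed
  have up: "s (m + d) = 0" if "m + d \<le> 2 * n - 3" for d
    using that
  proof (induction d)
    case (Suc d)
    then show ?case using log_convex[of "m + d"] by simp
  qed (simp add: m)
  have down: "s (m - d) = 0" if "1 \<le> m - d" for d
    using that
  proof (induction d)
    case (Suc d)
    then obtain e where "m - Suc d = Suc e" by (cases "m - Suc d") auto
    then have e: "m - Suc d = Suc e" "m - d = Suc (Suc e)" by auto
    then have "s (Suc (Suc e)) = 0" using Suc by simp
    then show ?case using log_convex[of e] m(1) e by simp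
  qed (simp add: m)
  show ?thesis
  proof (cases "k \<le> m")
    case True
    then show ?thesis using down[of "m - k"] k by simp
  next
    case False
    then show ?thesis using up[of "k - m"] k by simp
  qed
qed

text \<open>The shape that \<open>hankel_zero_entries\<close> leaves after \<open>F\<close> has been applied: a
constant matrix with additional non-negative weight in two opposite corners. The shifted matrix does
not contain these corners.\<close>

lemma psd_corner_matrix:
  assumes "0 \<le> c" "0 \<le> p" "0 \<le> r" "2 \<le> n"
    and s: "\<And>m. m \<le> 2 * n - 2 \<Longrightarrow> s m = c + (if m = 0 then p else 0) + (if m = 2 * n - 2 then r else 0)"
  shows "psd n (hankel s 0)" "psd (n - 1) (hankel s 1)"
proof -
  have const: "quad_form q (\<lambda>i j. c) v = c * (\<Sum>i<q. v i)\<^sup>2" for q v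
    by (simp add: quad_form_def power2_eq_square sum_product sum_distrib_left mult_ac)
  have corner: "quad_form n (\<lambda>i j. if i = l \<and> j = l then x else 0) v = x * (v l)\<^sup>2" if "l < n" for l x v
  proof -
    have "(\<Sum>j<n. v i * v j * (if i = l \<and> j = l then x else 0)) = (if i = l then x * (v l)\<^sup>2 else 0)" for i
      using that by (cases "i = l") (simp_all add: if_distrib[of "\<lambda>y. _ * y"] power2_eq_square mult_ac cong: if_cong)
    then show ?thesis using that by (simp add: quad_form_def)
  qed
  have "0 \<le> quad_form n (hankel s 0) v" for v
  proof -
    have "quad_form n (hankel s 0) v = quad_form n (\<lambda>i j. c + (if i = 0 \<and> j = 0 then p else 0) +
        (if i = n - 1 \<and> j = n - 1 then r else 0)) v"
      by (rule quad_form_cong) (use s assms(4) in \<open>auto simp: hankel_def\<close>)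
    also have "\<dots> = quad_form n (\<lambda>i j. c) v + quad_form n (\<lambda>i j. if i = 0 \<and> j = 0 then p else 0) v +
        quad_form n (\<lambda>i j. if i = n - 1 \<and> j = n - 1 then r else 0) v"
      unfolding quad_form_def distrib_left sum.distrib by simp
    also have "\<dots> = c * (\<Sum>i<n. v i)\<^sup>2 + p * (v 0)\<^sup>2 + r * (v (n - 1))\<^sup>2"
      using assms(4) by (simp add: const corner)
    finally show ?thesis using assms(1-3) by simp
  qed
  then show "psd n (hankel s 0)" by (simp add: psd_def)
  have "quad_form (n - 1) (hankel s 1) v = quad_form (n - 1) (\<lambda>i j. c) v" for v
    by (rule quad_form_cong) (use s assms(4) in \<open>auto simp: hankel_def\<close>)
  then show "psd (n - 1) (hankel s 1)" using assms(1) by (simp add: psd_def const)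
qed

lemma power_series_preserves_tn_hankel:
  assumes c: "\<And>n. 0 \<le> c n" and F: "\<And>x. 0 < x \<Longrightarrow> (\<lambda>n. c n * x ^ n) sums F x"
    and F0: "0 \<le> F 0" "F 0 \<le> c 0"
  shows "preserves_tn_hankel F"
  unfolding preserves_tn_hankel_def
proof
  fix A assume "A \<in> tn_hankel"
  then obtain n s where n: "1 \<le> n" and A: "A = hankel_mat n s"
    and psd: "psd n (hankel s 0)" "psd (n - 1) (hankel s 1)"
    unfolding tn_hankel_iff by blast
  have nonneg: "0 \<le> s m" if "m \<le> 2 * n - 2" for m
  proof (cases "even m")
    case True
    then obtain e where "m = 2 * e" by blast
    then show ?thesis using psd_diag[OF psd(1), of e] that n by (simp add: hankel_def mult_2)
  next
    case False
    then obtain e where "m = 2 * e + 1" using oddE by blast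
    then show ?thesis using psd_diag[OF psd(2), of e] that n by (simp add: hankel_def mult_2)
  qed
  have F_ge: "F 0 \<le> F x" if "0 \<le> x" for x
    using power_series_mono[OF c F, of x] that F0 by (cases "x = 0") auto
  define t where "t = (\<lambda>m. F (s m))"
  have "psd n (hankel t 0) \<and> psd (n - 1) (hankel t 1)"
  proof (cases "\<forall>m\<le>2 * n - 2. 0 < s m")
    case True
    have "psd n (hankel t 0)"
    proof (rule psd_power_series[OF symm_hankel psd(1) c])
      fix i j assume "i < n" "j < n"
      then have "0 < s (i + j)" using True by simp
      then show "(\<lambda>m. c m * hankel s 0 i j ^ m) sums hankel t 0 i j"
        using F by (simp add: hankel_def t_def)
    qed
    moreover have "psd (n - 1) (hankel t 1)"
    proof (rule psd_power_series[OF symm_hankel psd(2) c])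
      fix i j assume "i < n - 1" "j < n - 1"
      then have "0 < s (Suc (i + j))" using True by simp
      then show "(\<lambda>m. c m * hankel s 1 i j ^ m) sums hankel t 1 i j"
        using F by (simp add: hankel_def t_def)
    qed
    ultimately show ?thesis ..
  next
    case False
    then obtain m where "m \<le> 2 * n - 2" "\<not> 0 < s m" by blast
    then have m: "m \<le> 2 * n - 2" "s m = 0" using nonneg[of m] by auto
    show ?thesis
    proof (cases "n = 1")
      case True
      then show ?thesis
        using F0 m by (simp add: psd_def quad_form_def hankel_def t_def mult_nonneg_nonneg)
    next
      case False
      with n have n2: "2 \<le> n" by simp
      define p where "p = F (s 0) - F 0"
      define r where "r = F (s (2 * n - 2)) - F 0"
      have "t l = F 0 + (if l = 0 then p else 0) + (if l = 2 * n - 2 then r else 0)"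
        if "l \<le> 2 * n - 2" for l
        using hankel_zero_entries[OF psd m n2, of l] that n2
        by (cases "l = 0"; cases "l = 2 * n - 2") (auto simp: t_def p_def r_def)
      then show ?thesis
        using psd_corner_matrix[OF F0(1) _ _ n2, of p r t] F_ge[OF nonneg] by (auto simp: p_def r_def)
    qed
  qed
  then show "map_mat F A \<in> tn_hankel"
    unfolding tn_hankel_iff A map_mat_hankel t_def using n by blast
qed


section \<open>Necessity for totally non-negative Hankel matrices\<close>

lemma preserves_tn_hankel_imp_psd:
  assumes "preserves_tn_hankel F"
  shows "preserves_psd_on_tn_hankel F"
  unfolding preserves_psd_on_tn_hankel_def
proof
  fix A assume "A \<in> tn_hankel"
  then have "map_mat F A \<in> tn_hankel" using assms by (simp add: preserves_tn_hankel_def)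
  then obtain n s where "map_mat F A = hankel_mat n s" "psd n (hankel s 0)"
    unfolding tn_hankel_iff by blast
  then show "psd_mat (map_mat F A)" by (simp only: psd_mat_hankel_iff)
qed

lemma quad_form_two_atoms:
  "quad_form n (hankel (\<lambda>m. a * x ^ m + b * y ^ m) d) v =
    a * x ^ d * (\<Sum>i<n. v i * x ^ i)\<^sup>2 + b * y ^ d * (\<Sum>i<n. v i * y ^ i)\<^sup>2"
proof -
  have "a * x ^ d * (\<Sum>i<n. v i * x ^ i)\<^sup>2 =
      (\<Sum>i<n. \<Sum>j<n. v i * v j * (a * x ^ (d + i + j)))" for a x :: real
    unfolding power2_eq_square sum_product unfolding sum_distrib_left
    by (intro sum.cong refl) (simp add: power_add mult_ac)
  then show ?thesis by (simp add: quad_form_def hankel_def sum.distrib distrib_left)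
qed

lemma preserves_psd_imp_two_atom_psd:
  assumes "preserves_psd_on_tn_hankel F"
  shows "two_atom_psd F"
  unfolding two_atom_psd_def
proof (intro allI impI)
  fix a b x y :: real and n
  assume nonneg: "0 \<le> a" "0 \<le> b" "0 \<le> x" "0 \<le> y"
  define s where "s = (\<lambda>m. a * x ^ m + b * y ^ m)"
  show "psd n (hankel (\<lambda>m. F (a * x ^ m + b * y ^ m)) 0)"
  proof (cases "n = 0")
    case False
    have "psd q (hankel s d)" for q d
      unfolding psd_def s_def quad_form_two_atoms using nonneg by simp
    then have "hankel_mat n s \<in> tn_hankel"
      unfolding tn_hankel_iff using False by (intro exI[of _ n] exI[of _ s]) auto
    then have "psd_mat (map_mat F (hankel_mat n s))"
      using assms by (simp add: preserves_psd_on_tn_hankel_def)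
    then show ?thesis unfolding map_mat_hankel psd_mat_hankel_iff by (simp add: s_def)
  qed (simp add: psd_def quad_form_def)
qed

section \<open>Moment sequences\<close>

lemma moment_seq_psd:
  assumes "s \<in> moment_seqs K"
  shows "psd n (hankel s 0)"
proof -
  obtain M where M: "admissible_measure M" and s: "s = moment M"
    using assms unfolding moment_seqs_def by blast
  have [simp]: "integrable M (\<lambda>x. x ^ k)" for k
    using M by (simp add: admissible_measure_def)
  have "quad_form n (hankel s 0) v = (LINT x|M. (\<Sum>i<n. v i * x ^ i)\<^sup>2)" for v
  proof -
    have "(\<Sum>i<n. v i * x ^ i)\<^sup>2 = (\<Sum>i<n. \<Sum>j<n. v i * v j * x ^ (i + j))" for x
      unfolding power2_eq_square sum_product by (intro sum.cong refl) (simp add: power_add mult_ac)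
    then show ?thesis
      by (simp add: quad_form_def hankel_def s moment_def)
  qed
  then show ?thesis by (simp add: psd_def)
qed

lemma two_atom_moment_seq:
  assumes "0 \<le> a" "0 \<le> b" "0 \<le> x" "0 \<le> y"
  shows "(\<lambda>k. a * x ^ k + b * y ^ k) \<in> moment_seqs {0..}"
proof -
  define P where "P = point_measure {False, True} (\<lambda>i. if i then b else a)"
  define f where "f = (\<lambda>i. if i then y else x)"
  define M where "M = distr P borel f"
  have f [measurable]: "f \<in> P \<rightarrow>\<^sub>M borel" by (simp add: P_def measurable_point_measure_eq1)
  have "integrable M (\<lambda>x. x ^ k)" for k
    unfolding M_def using assms
    by (subst integrable_distr_eq) (auto simp: P_def intro!: integrable_point_measure_finite f[unfolded P_def])
  moreover have "moment M k = a * x ^ k + b * y ^ k" for k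
    unfolding moment_def M_def using assms
    by (subst integral_distr)
       (auto simp: P_def f_def lebesgue_integral_point_measure_finite measurable_point_measure_eq1)
  moreover have "AE z in M. z \<in> {0..}"
    unfolding M_def using assms
    by (subst AE_distr_iff) (auto simp: P_def AE_point_measure f_def measurable_point_measure_eq1)
  ultimately show ?thesis
    unfolding moment_seqs_def admissible_measure_def
    by (auto intro!: exI[of _ M] simp: M_def)
qed

lemma preserves_moment_seqs_imp_two_atom_psd:
  assumes "preserves_moment_seqs F {0..}"
  shows "two_atom_psd F"
  unfolding two_atom_psd_def
  using assms two_atom_moment_seq moment_seq_psd unfolding preserves_moment_seqs_def by blast

text \<open>Pushing a measure forward along the absolute value turns its absolute moments into moments of a
measure on the half-line. So supports need not be tracked through the constructions below.\<close>

lemma moment_seqsI_abs_moments: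
  assumes sets: "sets N = sets borel"
    and abs_moment: "\<And>k. (\<integral>\<^sup>+x. ennreal (\<bar>x\<bar> ^ k) \<partial>N) = ennreal (t k)" and t: "\<And>k. 0 \<le> t k"
  shows "t \<in> moment_seqs {0..}"
proof -
  note [measurable_cong] = sets
  define M where "M = distr N borel (\<lambda>x. \<bar>x\<bar>)"
  have "integrable N (\<lambda>x. \<bar>x\<bar> ^ k)" for k
    by (rule integrableI_nonneg) (auto simp: abs_moment)
  then have "integrable M (\<lambda>x. x ^ k)" for k
    unfolding M_def by (subst integrable_distr_eq) auto
  moreover have "moment M k = t k" for k
  proof -
    have "moment M k = (LINT x|N. \<bar>x\<bar> ^ k)"
      unfolding moment_def M_def by (subst integral_distr) auto
    also have "\<dots> = enn2real (\<integral>\<^sup>+x. ennreal (\<bar>x\<bar> ^ k) \<partial>N)"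
      by (rule integral_eq_nn_integral) auto
    finally show ?thesis by (simp add: abs_moment t)
  qed
  moreover have "AE x in M. x \<in> {0..}"
    unfolding M_def by (subst AE_distr_iff) auto
  ultimately show ?thesis
    unfolding moment_seqs_def admissible_measure_def
    by (auto intro!: exI[of _ M] simp: M_def)
qed

text \<open>The law of the product of \<open>j\<close> independent variables with law \<open>M\<close>.\<close>

primrec mult_conv_power :: "real measure \<Rightarrow> nat \<Rightarrow> real measure" where
  "mult_conv_power M 0 = return borel 1"
| "mult_conv_power M (Suc j) = distr (M \<Otimes>\<^sub>M mult_conv_power M j) borel (\<lambda>(x, y). x * y)"

lemma sets_mult_conv_power [simp, measurable_cong]: "sets (mult_conv_power M j) = sets borel"
  by (cases j) auto

lemma prob_space_mult_conv_power:
  assumes "prob_space M" and sets: "sets M = sets borel"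
  shows "prob_space (mult_conv_power M j)"
proof (induction j)
  case 0
  then show ?case by (simp add: prob_space_return)
next
  case (Suc j)
  note [measurable_cong] = sets
  interpret M: prob_space M by fact
  interpret N: prob_space "mult_conv_power M j" by fact
  interpret MN: pair_prob_space M "mult_conv_power M j" ..
  show ?case by (simp, rule MN.prob_space_distr) measurable
qed

lemma abs_moment_mult_conv_power:
  assumes "prob_space M" and sets: "sets M = sets borel"
  shows "(\<integral>\<^sup>+x. ennreal (\<bar>x\<bar> ^ k) \<partial>mult_conv_power M j) = (\<integral>\<^sup>+x. ennreal (\<bar>x\<bar> ^ k) \<partial>M) ^ j"
proof (induction j)
  case 0
  then show ?case by (simp add: nn_integral_return)
next
  case (Suc j)
  note [measurable_cong] = sets
  let ?N = "mult_conv_power M j"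
  interpret N: prob_space ?N by (rule prob_space_mult_conv_power[OF assms])
  have "(\<integral>\<^sup>+x. ennreal (\<bar>x\<bar> ^ k) \<partial>mult_conv_power M (Suc j)) =
      (\<integral>\<^sup>+z. ennreal (\<bar>fst z\<bar> ^ k) * ennreal (\<bar>snd z\<bar> ^ k) \<partial>(M \<Otimes>\<^sub>M ?N))"
    by (simp add: nn_integral_distr case_prod_beta abs_mult power_mult_distrib ennreal_mult)
  also have "\<dots> = (\<integral>\<^sup>+x. \<integral>\<^sup>+y. ennreal (\<bar>x\<bar> ^ k) * ennreal (\<bar>y\<bar> ^ k) \<partial>?N \<partial>M)"
    by (subst N.nn_integral_fst[symmetric]) auto
  also have "\<dots> = (\<integral>\<^sup>+x. ennreal (\<bar>x\<bar> ^ k) \<partial>M) * (\<integral>\<^sup>+y. ennreal (\<bar>y\<bar> ^ k) \<partial>?N)"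
    by (simp add: nn_integral_cmult nn_integral_multc)
  finally show ?case by (simp add: Suc)
qed

text \<open>The required measure is \<open>\<Sum>j. c j * M\<^sub>j\<close>, where \<open>M\<^sub>j\<close> is
the \<open>j\<close>-th multiplicative convolution power of \<open>M\<close>. It is realised as a
multiple of a probabilistic mixture: draw \<open>j\<close> with probability proportional to \<open>c
j\<close>, then a point from \<open>M\<^sub>j\<close>.\<close>

lemma power_series_mixture_abs_moments:
  assumes M: "prob_space M" "sets M = sets borel"
    and u: "\<And>k. (\<integral>\<^sup>+x. ennreal (\<bar>x\<bar> ^ k) \<partial>M) = ennreal (u k)" "\<And>k. 0 \<le> u k" "u 0 = 1"
    and c: "\<And>j. 0 \<le> c j" and t: "\<And>k. (\<lambda>j. c j * u k ^ j) sums t k"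
  shows "t \<in> moment_seqs {0..}"
proof -
  have t_nonneg: "0 \<le> t k" for k
    by (rule sums_le[OF _ sums_zero t]) (use c u in simp)
  show ?thesis
  proof (cases "t 0 = 0")
    case True
    have "c j = 0" for j
    proof -
      have "suminf c = 0" "summable c" using t[of 0] True u(3) by (auto simp: sums_iff)
      then show ?thesis using suminf_eq_zero_iff[of c] c by auto
    qed
    then have "t k = 0" for k using sums_unique2[OF t[of k]] by simp
    then have "t = (\<lambda>k. 0 * 0 ^ k + 0 * 0 ^ k)" by auto
    then show ?thesis using two_atom_moment_seq[of 0 0 0 0] by simp
  next
    case False
    then have t0: "0 < t 0" using t_nonneg[of 0] by simp
    define w where "w = (\<lambda>j. c j / t 0)"
    have w: "0 \<le> w j" for j using c t0 by (simp add: w_def)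
    have w_sums: "(\<lambda>j. w j * u k ^ j) sums (t k / t 0)" for k
      using sums_divide[OF t[of k], of "t 0"] by (simp add: w_def)
    have nn_sum: "(\<Sum>j. ennreal (w j * u k ^ j)) = ennreal (t k / t 0)" for k
      using w_sums[of k] w u(2) by (subst suminf_ennreal2) (auto simp: sums_iff)
    define p where "p = embed_pmf w"
    have pmf_p: "pmf p j = w j" for j
      unfolding p_def
    proof (rule pmf_embed_pmf)
      show "(\<integral>\<^sup>+j. ennreal (w j) \<partial>count_space UNIV) = 1"
        using nn_sum[of 0] u(3) t0 by (simp add: nn_integral_count_space_nat)
    qed (rule w)
    define N where "N = scale_measure (ennreal (t 0)) (measure_pmf p \<bind> mult_conv_power M)"
    have kernel [measurable]: "mult_conv_power M \<in> measure_pmf p \<rightarrow>\<^sub>M subprob_algebra borel"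
    proof -
      have "mult_conv_power M j \<in> space (subprob_algebra borel)" for j
        using prob_space_imp_subprob_space[OF prob_space_mult_conv_power[OF M, of j]]
        by (simp add: space_subprob_algebra)
      then show ?thesis unfolding measurable_pmf_measure1 by (rule Pi_I)
    qed
    have sets_N: "sets N = sets borel"
      unfolding N_def by (simp add: sets_bind[where N = borel])
    have "(\<integral>\<^sup>+x. ennreal (\<bar>x\<bar> ^ k) \<partial>N) = ennreal (t k)" for k
    proof -
      have "(\<integral>\<^sup>+x. ennreal (\<bar>x\<bar> ^ k) \<partial>(measure_pmf p \<bind> mult_conv_power M)) =
          (\<integral>\<^sup>+j. \<integral>\<^sup>+x. ennreal (\<bar>x\<bar> ^ k) \<partial>mult_conv_power M j \<partial>measure_pmf p)"
        by (rule nn_integral_bind[OF _ kernel]) measurable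
      also have "\<dots> = (\<Sum>j. ennreal (pmf p j) * ennreal (u k) ^ j)"
        by (simp add: nn_integral_measure_pmf nn_integral_count_space_nat abs_moment_mult_conv_power[OF M] u(1))
      also have "\<dots> = (\<Sum>j. ennreal (w j * u k ^ j))"
        using w u(2) by (simp add: pmf_p ennreal_mult ennreal_power)
      finally have "(\<integral>\<^sup>+x. ennreal (\<bar>x\<bar> ^ k) \<partial>(measure_pmf p \<bind> mult_conv_power M)) = ennreal (t k / t 0)"
        by (simp add: nn_sum)
      then have "(\<integral>\<^sup>+x. ennreal (\<bar>x\<bar> ^ k) \<partial>N) = ennreal (t 0) * ennreal (t k / t 0)"
        unfolding N_def by (subst nn_integral_scale_measure) (auto simp: sets_bind[where N = borel] cong: measurable_cong_sets)
      then show ?thesis using t0 t_nonneg[of k] by (simp add: ennreal_mult[symmetric])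
    qed
    then show ?thesis by (rule moment_seqsI_abs_moments[OF sets_N]) (rule t_nonneg)
  qed
qed

lemma power_series_preserves_moment_seqs:
  assumes c: "\<And>n. 0 \<le> c n" and F: "\<And>x. 0 < x \<Longrightarrow> (\<lambda>n. c n * x ^ n) sums F x"
    and F0: "0 \<le> F 0" "F 0 \<le> c 0"
  shows "preserves_moment_seqs F {0..}"
  unfolding preserves_moment_seqs_def
proof
  fix s assume "s \<in> moment_seqs {0..}"
  then obtain M where M: "admissible_measure M" "AE x in M. x \<in> {0..}" and s: "s = moment M"
    unfolding moment_seqs_def by blast
  have sets [measurable_cong]: "sets M = sets borel" and int [simp]: "integrable M (\<lambda>x. x ^ k)" for k
    using M(1) by (auto simp: admissible_measure_def)
  have AE_nonneg: "AE x in M. 0 \<le> x ^ k" for k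
    using M(2) by (auto elim!: eventually_mono)
  have s_nonneg: "0 \<le> s k" for k
    unfolding s moment_def by (rule integral_nonneg_AE[OF AE_nonneg])
  have F_ge: "F 0 \<le> F x" if "0 \<le> x" for x
    using power_series_mono[OF c F, of x] that F0 by (cases "x = 0") auto
  show "(\<lambda>k. F (s k)) \<in> moment_seqs {0..}"
  proof (cases "\<exists>k. s k = 0")
    case True
    then obtain k where "s k = 0" by blast
    then have "AE x in M. x ^ k = 0"
      using integral_nonneg_eq_0_iff_AE[OF int AE_nonneg, of k] by (simp add: s moment_def)
    then have "AE x in M. x ^ m = 0" if "1 \<le> m" for m
      using that by (auto elim!: eventually_mono simp: power_0_left)
    then have "s m = 0" if "1 \<le> m" for m
      unfolding s moment_def using that by (intro integral_eq_zero_AE) auto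
    \<comment> \<open>the moments of an atom of mass \<open>F 0\<close> at 1 and one of mass \<open>F (s 0) - F 0\<close> at 0; here \<open>0 ^ 0 = 1\<close>\<close>
    then have "(\<lambda>k. F (s k)) = (\<lambda>k. F 0 * 1 ^ k + (F (s 0) - F 0) * 0 ^ k)"
      by (auto simp: fun_eq_iff power_0_left)
    then show ?thesis
      using two_atom_moment_seq[of "F 0" "F (s 0) - F 0" 1 0] F0 F_ge[OF s_nonneg] by simp
  next
    case False
    then have pos: "0 < s k" for k using s_nonneg[of k] by (metis less_le)
    have abs_moment: "(\<integral>\<^sup>+x. ennreal (\<bar>x\<bar> ^ k) \<partial>M) = ennreal (s k)" for k
    proof -
      have "(\<integral>\<^sup>+x. ennreal (\<bar>x\<bar> ^ k) \<partial>M) = (\<integral>\<^sup>+x. ennreal (x ^ k) \<partial>M)"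
        by (rule nn_integral_cong_AE) (use M(2) in \<open>auto elim!: eventually_mono\<close>)
      also have "\<dots> = ennreal (s k)"
        unfolding s moment_def by (rule nn_integral_eq_integral[OF int AE_nonneg])
      finally show ?thesis .
    qed
    \<comment> \<open>normalise the total mass, as the mixture is one of probability measures; the factor goes into the coefficients\<close>
    define P where "P = scale_measure (ennreal (1 / s 0)) M"
    have sets_P: "sets P = sets borel" by (simp add: P_def sets)
    have abs_moment_P: "(\<integral>\<^sup>+x. ennreal (\<bar>x\<bar> ^ k) \<partial>P) = ennreal (s k / s 0)" for k
      unfolding P_def using pos[of 0] pos[of k]
      by (subst nn_integral_scale_measure) (auto simp: abs_moment ennreal_mult[symmetric])
    have "prob_space P"
      using abs_moment_P[of 0] pos[of 0] by (intro prob_spaceI) simp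
    then show ?thesis
    proof (rule power_series_mixture_abs_moments[OF _ sets_P abs_moment_P])
      show "(\<lambda>j. c j * s 0 ^ j * (s k / s 0) ^ j) sums F (s k)" for k
        using F[OF pos[of k]] pos[of 0] by (simp add: power_divide)
      show "0 \<le> s k / s 0" "0 \<le> c k * s 0 ^ k" for k
        using s_nonneg c by simp_all
      show "s 0 / s 0 = 1" using pos[of 0] by simp
    qed
  qed
qed


section \<open>The equivalences\<close>

theorem theorem3p3:
  fixes F :: "real \<Rightarrow> real"
  shows
    "(preserves_psd_on_tn_hankel F \<longleftrightarrow> preserves_tn_hankel F) \<and>
     (preserves_tn_hankel F \<longleftrightarrow> preserves_moment_seqs F {0..}) \<and>
     (preserves_moment_seqs F {0..} \<longleftrightarrow>
        (\<exists>g. abs_monotonic_entire g \<and> (\<forall>x>0. complex_of_real (F x) = g (complex_of_real x))) \<and>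
        (\<exists>L. (F \<longlongrightarrow> L) (at_right 0) \<and> 0 \<le> F 0 \<and> F 0 \<le> L))"
proof -
  let ?analytic = "(\<exists>g. abs_monotonic_entire g \<and> (\<forall>x>0. complex_of_real (F x) = g (complex_of_real x))) \<and>
        (\<exists>L. (F \<longlongrightarrow> L) (at_right 0) \<and> 0 \<le> F 0 \<and> F 0 \<le> L)"
  have sufficient: "preserves_tn_hankel F \<and> preserves_moment_seqs F {0..}" if ?analytic
  proof -
    from that obtain g L where g: "abs_monotonic_entire g"
        "\<And>x. 0 < x \<Longrightarrow> complex_of_real (F x) = g (complex_of_real x)"
      and L: "(F \<longlongrightarrow> L) (at_right 0)" "0 \<le> F 0" "F 0 \<le> L"
      by blast
    from power_series_of_abs_monotonic[OF g L(1)] obtain c where c: "\<And>n. 0 \<le> c n"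
        "\<And>x. 0 < x \<Longrightarrow> (\<lambda>n. c n * x ^ n) sums F x" "c 0 = L"
      by blast
    have "F 0 \<le> c 0" using L(3) c(3) by simp
    with power_series_preserves_tn_hankel[OF c(1,2) L(2)]
      power_series_preserves_moment_seqs[OF c(1,2) L(2)]
    show ?thesis by blast
  qed
  have "preserves_psd_on_tn_hankel F \<Longrightarrow> ?analytic"
    by (intro two_atom_psd_imp_abs_monotonic preserves_psd_imp_two_atom_psd)
  moreover have "preserves_moment_seqs F {0..} \<Longrightarrow> ?analytic"
    by (intro two_atom_psd_imp_abs_monotonic preserves_moment_seqs_imp_two_atom_psd)
  moreover have "preserves_tn_hankel F \<Longrightarrow> preserves_psd_on_tn_hankel F"
    by (rule preserves_tn_hankel_imp_psd)
  ultimately show ?thesis using sufficient by blast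
qed

end
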